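(* Let $G$ be an $\mathcal{M}_{2,2}^*$-circuit which is distinct from $K_5-e$, $H_1$ and $H_2$, and suppose that $G$ has no nontrivial $2$-vertex-separation and no nontrivial $3$-edge-separation. Then $G$ has at least two admissible nodes.
   Context: All graphs are finite and simple. A graph $G=(V,E)$ is an $\mathcal{M}_{2,2}^*$-circuit if $|E|=2|V|-1$ and every nonempty proper subset $F\subsetneq E$ satisfies $|F|\le 2|V(F)|-2$, where $V(F)$ is the set of vertices incident with $F$. $K_5-e$ is $K_5$ minus one edge. $H_1$ is two copies of $K_4$ sharing exactly one edge (6 vertices, 11 edges). $H_2$ is the graph on vertices $v_1,\dots,v_7$ in which $\{v_1,v_2,v_3,v_4\}$ and $\{v_4,v_5,v_6,v_7\}$ each induce a $K_4$, plus the single extra edge $v_1v_7$ (7 vertices, 13 edges). A $2$-vertex-separation of $G$ is a pair of induced subgraphs $F_1=(V_1,E_1)$, $F_2=(V_2,E_2)$ with $F_1\cup F_2=G$, $|V_1\cap V_2|=2$ and $V_1\setminus V_2\ne\emptyset\ne V_2\setminus V_1$; it is nontrivial if neither $F_1$ nor $F_2$ is isomorphic to $K_4$. A $3$-edge-separation is a pair of nonempty vertex-disjoint induced subgraphs $(F_1,F_2)$ with $F_1\cup F_2=G-S$ for some edge set $S$ with $|S|=3$; it is nontrivial if the three edges of $S$ are pairwise non-adjacent (share no endpoints). A node is a vertex of degree $3$. A $1$-reduction at a node $v$ with neighbours $x,y,z$ deletes $v$ and adds an edge between two of $x,y,z$ that are not already adjacent (the inverse of a $1$-extension). A node $v$ of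 an $\mathcal{M}_{2,2}^*$-circuit $G$ is admissible if some $1$-reduction at $v$ produces an $\mathcal{M}_{2,2}^*$-circuit. *)

theory Defs
  imports Main
begin

type_synonym 'a ugraph = "'a set \<times> 'a set set"

abbreviation verts :: "'a ugraph \<Rightarrow> 'a set" where "verts \<equiv> fst"
abbreviation edges :: "'a ugraph \<Rightarrow> 'a set set" where "edges \<equiv> snd"

definition simple_graph :: "'a ugraph \<Rightarrow> bool" where
  "simple_graph G \<longleftrightarrow> finite (verts G) \<and> (\<forall>e \<in> edges G. e \<subseteq> verts G \<and> card e = 2)"

definition graph_iso :: "'a ugraph \<Rightarrow> 'b ugraph \<Rightarrow> bool" where
  "graph_iso G H \<longleftrightarrow>
     (\<exists>f. bij_betw f (verts G) (verts H) \<and> (\<lambda>e. f ` e) ` edges G = edges H)"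

definition graph_union :: "'a ugraph \<Rightarrow> 'a ugraph \<Rightarrow> 'a ugraph" where
  "graph_union G H = (verts G \<union> verts H, edges G \<union> edges H)"

definition delete_edges :: "'a ugraph \<Rightarrow> 'a set set \<Rightarrow> 'a ugraph" where
  "delete_edges G S = (verts G, edges G - S)"

definition add_edge :: "'a ugraph \<Rightarrow> 'a set \<Rightarrow> 'a ugraph" where
  "add_edge G e = (verts G, insert e (edges G))"

definition delete_vertex :: "'a ugraph \<Rightarrow> 'a \<Rightarrow> 'a ugraph" where
  "delete_vertex G v = (verts G - {v}, {e \<in> edges G. v \<notin> e})"

definition induced_subgraph :: "'a ugraph \<Rightarrow> 'a ugraph \<Rightarrow> bool" where
  "induced_subgraph F G \<longleftrightarrow>
     verts F \<subseteq> verts G \<and> edges F = {e \<in> edges G. e \<subseteq> verts F}"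

definition complete_graph :: "'a set \<Rightarrow> 'a ugraph" where
  "complete_graph A = (A, {e. e \<subseteq> A \<and> card e = 2})"

definition K4 :: "nat ugraph" where
  "K4 = complete_graph {1, 2, 3, 4}"

definition K5_minus_edge :: "nat ugraph" where
  "K5_minus_edge = delete_edges (complete_graph {1, 2, 3, 4, 5}) {{1, 2}}"

definition H1 :: "nat ugraph" where
  "H1 = graph_union (complete_graph {1, 2, 3, 4}) (complete_graph {3, 4, 5, 6})"

definition H2 :: "nat ugraph" where
  "H2 = add_edge (graph_union (complete_graph {1, 2, 3, 4}) (complete_graph {4, 5, 6, 7})) {1, 7}"

text \<open>The circuits of the simple (2,2)-sparsity matroid. The equation
  |E| = 2|V| - 1 and the bound |F| \<le> 2|V(F)| - 2 are written additively to avoid truncated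
  subtraction on the natural numbers; the vertex set V(F) is \<Union>F.\<close>

definition M22_circuit :: "'a ugraph \<Rightarrow> bool" where
  "M22_circuit G \<longleftrightarrow>
     simple_graph G \<and>
     card (edges G) + 1 = 2 * card (verts G) \<and>
     (\<forall>F. F \<noteq> {} \<and> F \<subset> edges G \<longrightarrow> card F + 2 \<le> 2 * card (\<Union>F))"

definition two_vertex_separation :: "'a ugraph \<Rightarrow> 'a ugraph \<Rightarrow> 'a ugraph \<Rightarrow> bool" where
  "two_vertex_separation G F1 F2 \<longleftrightarrow>
     induced_subgraph F1 G \<and> induced_subgraph F2 G \<and> graph_union F1 F2 = G \<and>
     card (verts F1 \<inter> verts F2) = 2 \<and>
     verts F1 - verts F2 \<noteq> {} \<and> verts F2 - verts F1 \<noteq> {}"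

definition nontrivial_two_vertex_separation :: "'a ugraph \<Rightarrow> 'a ugraph \<Rightarrow> 'a ugraph \<Rightarrow> bool" where
  "nontrivial_two_vertex_separation G F1 F2 \<longleftrightarrow>
     two_vertex_separation G F1 F2 \<and> \<not> graph_iso F1 K4 \<and> \<not> graph_iso F2 K4"

definition three_edge_separation ::
    "'a ugraph \<Rightarrow> 'a ugraph \<Rightarrow> 'a ugraph \<Rightarrow> 'a set set \<Rightarrow> bool" where
  "three_edge_separation G F1 F2 S \<longleftrightarrow>
     induced_subgraph F1 G \<and> induced_subgraph F2 G \<and>
     verts F1 \<noteq> {} \<and> verts F2 \<noteq> {} \<and> verts F1 \<inter> verts F2 = {} \<and>
     S \<subseteq> edges G \<and> card S = 3 \<and> graph_union F1 F2 = delete_edges G S"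

definition nontrivial_three_edge_separation ::
    "'a ugraph \<Rightarrow> 'a ugraph \<Rightarrow> 'a ugraph \<Rightarrow> 'a set set \<Rightarrow> bool" where
  "nontrivial_three_edge_separation G F1 F2 S \<longleftrightarrow>
     three_edge_separation G F1 F2 S \<and> pairwise disjnt S"

definition neighbours :: "'a ugraph \<Rightarrow> 'a \<Rightarrow> 'a set" where
  "neighbours G v = {u. {u, v} \<in> edges G}"

definition vert_degree :: "'a ugraph \<Rightarrow> 'a \<Rightarrow> nat" where
  "vert_degree G v = card {e \<in> edges G. v \<in> e}"

definition node :: "'a ugraph \<Rightarrow> 'a \<Rightarrow> bool" where
  "node G v \<longleftrightarrow> v \<in> verts G \<and> vert_degree G v = 3"

definition one_reduction :: "'a ugraph \<Rightarrow> 'a \<Rightarrow> 'a ugraph \<Rightarrow> bool" where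
  "one_reduction G v H \<longleftrightarrow>
     node G v \<and>
     (\<exists>x \<in> neighbours G v. \<exists>y \<in> neighbours G v.
        x \<noteq> y \<and> {x, y} \<notin> edges G \<and> H = add_edge (delete_vertex G v) {x, y})"

definition admissible_node :: "'a ugraph \<Rightarrow> 'a \<Rightarrow> bool" where
  "admissible_node G v \<longleftrightarrow> node G v \<and> (\<exists>H. one_reduction G v H \<and> M22_circuit H)"

end

theory Submission
  imports Defs
begin

text \<open>
  Call a nonempty proper vertex set \<open>X\<close> critical if it induces \<open>2|X| - 2\<close> edges, the maximum
  allowed, and tight if its complement is critical, i.e. exactly \<open>2|X| + 1\<close> edges meet it. Tight
  sets can be uncrossed, single nodes are tight, and sets of nodes induce forests.

  A node outside every \<open>K\<^sub>4\<close> that is not admissible has pairwise disjoint tight sets around its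
  neighbours, each avoiding the node and containing just one neighbour (otherwise there is a
  nontrivial 2-vertex-separation). Counting degrees over the maximal critical subsets of a tight set,
  with \<open>K\<^sub>4\<close>s that cross its boundary peeled off, produces nodes outside every \<open>K\<^sub>4\<close>. By descent, a
  tight set that lies in no \<open>K\<^sub>4\<close> and does not consist of such nodes only contains an admissible
  node: take a leaf of the forest of such nodes inside it and intersect with the tight sets around
  its neighbours, or delete the leaf. Finally, consider two leaves of the forest of all nodes outside
  every \<open>K\<^sub>4\<close>. Either both are admissible, or a non-admissible one has two neighbours that are not
  such nodes, and the disjoint tight sets around these contain an admissible node each.
\<close>

section \<open>Double counting and transport of edge sets along bijections\<close>

lemma sum_card_incident:
  assumes "finite F" "finite X"
  shows "(\<Sum>x\<in>X. card {e \<in> F. x \<in> e}) = (\<Sum>e\<in>F. card (e \<inter> X))"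
proof -
  have "(\<Sum>x\<in>X. card {e \<in> F. x \<in> e}) = (\<Sum>x\<in>X. \<Sum>e\<in>F. if x \<in> e then 1 else 0)"
    using assms(1) by (simp add: sum.If_cases Int_def)
  also have "\<dots> = (\<Sum>e\<in>F. \<Sum>x\<in>X. if x \<in> e then 1 else 0)"
    by (rule sum.swap)
  also have "\<dots> = (\<Sum>e\<in>F. card (e \<inter> X))"
    using assms(2) by (simp add: sum.If_cases Int_def conj_commute)
  finally show ?thesis .
qed

lemma image_pairs:
  assumes "inj_on f A"
  shows "(`) f ` {e. e \<subseteq> A \<and> card e = 2} = {e. e \<subseteq> f ` A \<and> card e = 2}"
proof (intro equalityI subsetI)
  fix e assume "e \<in> (`) f ` {e. e \<subseteq> A \<and> card e = 2}"
  then obtain d where "d \<subseteq> A" "card d = 2" "e = f ` d" by auto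
  then show "e \<in> {e. e \<subseteq> f ` A \<and> card e = 2}"
    using card_image[OF inj_on_subset[OF assms]] by auto
next
  fix e assume "e \<in> {e. e \<subseteq> f ` A \<and> card e = 2}"
  then obtain d where d: "d \<subseteq> A" "e = f ` d" "card e = 2" by (auto simp: subset_image_iff)
  then show "e \<in> (`) f ` {e. e \<subseteq> A \<and> card e = 2}"
    using card_image[OF inj_on_subset[OF assms d(1)]] by auto
qed

lemma graph_iso_sym:
  assumes "graph_iso G H" "\<And>e. e \<in> edges G \<Longrightarrow> e \<subseteq> verts G"
  shows "graph_iso H G"
proof -
  obtain f where f: "bij_betw f (verts G) (verts H)" "(`) f ` edges G = edges H"
    using assms(1) unfolding graph_iso_def by auto
  let ?g = "the_inv_into (verts G) f"
  have "?g ` f ` e = e" if "e \<in> edges G" for e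
    using assms(2)[OF that] f(1)
    by (force simp: bij_betw_def image_image the_inv_into_f_f subset_iff)
  then have "(`) ?g ` edges H = edges G"
    unfolding f(2)[symmetric] by (force simp: image_image)
  then show ?thesis
    unfolding graph_iso_def using bij_betw_the_inv_into[OF f(1)] by blast
qed

section \<open>Sparsity, critical sets and tight sets of a circuit\<close>

locale circuit =
  fixes G :: "'a ugraph"
  assumes circuit: "M22_circuit G"
begin

abbreviation V where "V \<equiv> verts G"
abbreviation E where "E \<equiv> edges G"

definition ind :: "'a set \<Rightarrow> nat" where
  "ind X = card {e \<in> E. e \<subseteq> X}"

text \<open>Dual to \<open>ind\<close> under complements: every edge either meets \<open>A\<close>
  or lies in \<open>V - A\<close>, so upper bounds on \<open>ind\<close> become lower bounds on
  \<open>touch\<close>.\<close>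

definition touch :: "'a set \<Rightarrow> nat" where
  "touch A = card {e \<in> E. e \<inter> A \<noteq> {}}"

text \<open>Singletons satisfy the equation as well, so every vertex lies in some critical
  set.\<close>

definition critical :: "'a set \<Rightarrow> bool" where
  "critical X \<longleftrightarrow> X \<noteq> {} \<and> X \<subset> V \<and> ind X + 2 = 2 * card X"

text \<open>The value \<open>2 * card A + 1\<close> is the least that sparsity of the complement
  allows.\<close>

definition tight :: "'a set \<Rightarrow> bool" where
  "tight A \<longleftrightarrow> A \<noteq> {} \<and> A \<subset> V \<and> touch A = 2 * card A + 1"

definition K4_set :: "'a set \<Rightarrow> bool" where
  "K4_set K \<longleftrightarrow> K \<subseteq> V \<and> card K = 4 \<and> ind K = 6"

lemma finite_V [simp]: "finite V"
  using circuit by (simp add: M22_circuit_def simple_graph_def)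

lemma edge: "e \<in> E \<Longrightarrow> e \<subseteq> V \<and> card e = 2"
  using circuit by (auto simp: M22_circuit_def simple_graph_def)

lemma finite_E [simp]: "finite E"
  by (rule finite_subset[of _ "Pow V"]) (use edge in auto)

lemma finite_sub [simp]: "X \<subseteq> V \<Longrightarrow> finite X"
  by (rule finite_subset[OF _ finite_V])

lemma card_E: "card E + 1 = 2 * card V"
  using circuit by (simp add: M22_circuit_def)

lemma edgeE:
  assumes "e \<in> E" "x \<in> e"
  obtains y where "e = {x, y}" "x \<noteq> y" "y \<in> V"
  using edge[OF assms(1)] assms(2) by (auto simp: card_2_iff)

lemma adj: "{x, y} \<in> E \<Longrightarrow> x \<noteq> y \<and> x \<in> V \<and> y \<in> V"
  using edge[of "{x, y}"] by (auto simp: card_insert_if)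

lemma ind_le_choose:
  assumes "X \<subseteq> V"
  shows "ind X \<le> card X choose 2"
proof -
  have "ind X \<le> card {e. e \<subseteq> X \<and> card e = 2}"
    unfolding ind_def using assms edge by (intro card_mono) (auto intro: finite_subset)
  then show ?thesis using assms by (simp add: n_subsets)
qed

lemma ind_V: "ind V = card E"
proof -
  have "{e \<in> E. e \<subseteq> V} = E" using edge by auto
  then show ?thesis by (simp add: ind_def)
qed

text \<open>On one to four vertices there are fewer pairs than the edge equation demands, and zero
  vertices contradict it outright.\<close>

lemma card_V_ge_5: "card V \<ge> 5"
proof (rule ccontr)
  assume "\<not> ?thesis"
  then have "card V = 0 \<or> card V = 1 \<or> card V = 2 \<or> card V = 3 \<or> card V = 4" by linarith
  then show False using card_E ind_le_choose[of V] ind_V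
    by (elim disjE) (simp_all add: choose_two)
qed

text \<open>Passes from edge sets to vertex sets. The edges inside \<open>X\<close> cannot be all of
  \<open>E\<close>: dropping one of them would leave \<open>2 * card V - 2\<close> edges on fewer
  than \<open>card V\<close> vertices.\<close>

lemma sparse:
  assumes "X \<noteq> {}" "X \<subset> V"
  shows "ind X + 2 \<le> 2 * card X"
proof -
  let ?F = "{e \<in> E. e \<subseteq> X}"
  have fX: "finite X" using assms by auto
  have cX: "card X < card V" using assms by (simp add: psubset_card_mono)
  have sp: "card F + 2 \<le> 2 * card (\<Union>F)" if "F \<noteq> {}" "F \<subset> E" for F
    using circuit that by (simp add: M22_circuit_def)
  have ne: "?F \<noteq> E"
  proof
    assume all: "?F = E"
    have "E \<noteq> {}" using card_E card_V_ge_5 by auto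
    then obtain e where e: "e \<in> E" by auto
    have c: "card (E - {e}) + 2 = 2 * card V" using e card_E card_V_ge_5 by simp
    then have "card (E - {e}) \<noteq> 0" using card_V_ge_5 by linarith
    then have "E - {e} \<noteq> {}" by (metis card.empty)
    then have "card (E - {e}) + 2 \<le> 2 * card (\<Union>(E - {e}))" using e by (intro sp) auto
    also have "card (\<Union>(E - {e})) \<le> card X" using all fX by (intro card_mono) auto
    finally show False using c cX by simp
  qed
  show ?thesis
  proof (cases "?F = {}")
    case True
    then have "ind X = 0" unfolding ind_def by (metis card.empty)
    moreover have "card X \<noteq> 0" using assms fX by simp
    ultimately show ?thesis by linarith
  next
    case False
    then have "card ?F + 2 \<le> 2 * card (\<Union>?F)" using ne by (intro sp) auto
    also have "card (\<Union>?F) \<le> card X" using fX by (intro card_mono) auto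
    finally show ?thesis by (simp add: ind_def)
  qed
qed

lemma touch_ind:
  assumes "A \<subseteq> V"
  shows "touch A + ind (V - A) = card E"
proof -
  have "{e \<in> E. e \<inter> A \<noteq> {}} \<union> {e \<in> E. e \<subseteq> V - A} = E" using edge by blast
  moreover have "{e \<in> E. e \<inter> A \<noteq> {}} \<inter> {e \<in> E. e \<subseteq> V - A} = {}" by blast
  ultimately show ?thesis unfolding touch_def ind_def
    by (metis (no_types, lifting) card_Un_disjoint finite_E finite_Un)
qed

lemma touch_V: "touch V = card E"
  using touch_ind[of V] ind_le_choose[of "{}"] by (simp add: choose_two)

lemma card_compl: "A \<subseteq> V \<Longrightarrow> card A + card (V - A) = card V"
  by (metis Diff_partition Diff_disjoint card_Un_disjoint finite_Diff finite_V finite_sub)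

lemma touch_ge:
  assumes "A \<noteq> {}" "A \<subset> V"
  shows "touch A \<ge> 2 * card A + 1"
proof -
  have "ind (V - A) + 2 \<le> 2 * card (V - A)" using assms by (intro sparse) auto
  then show ?thesis using touch_ind[of A] card_compl[of A] card_E assms by auto
qed

lemma tight_iff_critical:
  assumes "A \<subseteq> V"
  shows "tight A \<longleftrightarrow> critical (V - A)"
proof -
  have "touch A = 2 * card A + 1 \<longleftrightarrow> ind (V - A) + 2 = 2 * card (V - A)"
    using touch_ind[OF assms] card_compl[OF assms] card_E by linarith
  then show ?thesis using assms unfolding tight_def critical_def by auto
qed

lemma critical_iff_tight: "X \<subseteq> V \<Longrightarrow> critical X \<longleftrightarrow> tight (V - X)"
  by (simp add: tight_iff_critical double_diff)

text \<open>The last summand counts the edges between \<open>A - B\<close> and \<open>B - A\<close>;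
  it measures the failure of \<open>touch\<close> to be modular.\<close>

lemma touch_uncross:
  "touch A + touch B = touch (A \<union> B) + touch (A \<inter> B)
     + card {e \<in> E. e \<inter> A \<noteq> {} \<and> e \<inter> B \<noteq> {} \<and> e \<inter> (A \<inter> B) = {}}"
proof -
  let ?T = "\<lambda>A. {e \<in> E. e \<inter> A \<noteq> {}}"
  let ?C = "{e \<in> E. e \<inter> A \<noteq> {} \<and> e \<inter> B \<noteq> {} \<and> e \<inter> (A \<inter> B) = {}}"
  have "card (?T A) + card (?T B) = card (?T A \<union> ?T B) + card (?T A \<inter> ?T B)"
    by (rule card_Un_Int) auto
  moreover have "?T A \<union> ?T B = ?T (A \<union> B)" by auto
  moreover have "card (?T A \<inter> ?T B) = card (?T (A \<inter> B)) + card ?C"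
    by (subst card_Un_disjoint[symmetric]) (auto intro!: arg_cong[of _ _ card])
  ultimately show ?thesis by (simp add: touch_def)
qed

text \<open>Intersection and union each obey the lower bound for \<open>touch\<close>, while
  \<open>A\<close> and \<open>B\<close> attain it. Submodularity then forces equality everywhere and
  leaves no edge between the two differences.\<close>

lemma tight_uncross:
  assumes "tight A" "tight B" "A \<inter> B \<noteq> {}" "A \<union> B \<noteq> V"
  shows "tight (A \<inter> B)" "tight (A \<union> B)"
    and "\<And>a b. a \<in> A - B \<Longrightarrow> b \<in> B - A \<Longrightarrow> {a, b} \<notin> E"
proof -
  let ?C = "{e \<in> E. e \<inter> A \<noteq> {} \<and> e \<inter> B \<noteq> {} \<and> e \<inter> (A \<inter> B) = {}}"
  have f: "finite A" "finite B" and sub: "A \<union> B \<subset> V" "A \<inter> B \<subset> V"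
    using assms unfolding tight_def by auto
  have "touch (A \<inter> B) \<ge> 2 * card (A \<inter> B) + 1" "touch (A \<union> B) \<ge> 2 * card (A \<union> B) + 1"
    using assms(3) sub by (intro touch_ge; blast)+
  moreover have "touch A = 2 * card A + 1" "touch B = 2 * card B + 1"
    using assms by (auto simp: tight_def)
  moreover note touch_uncross[of A B] card_Un_Int[OF f]
  ultimately have eq: "touch (A \<inter> B) = 2 * card (A \<inter> B) + 1"
      "touch (A \<union> B) = 2 * card (A \<union> B) + 1" "card ?C = 0"
    by linarith+
  show "tight (A \<inter> B)" "tight (A \<union> B)"
    using eq sub assms(3) by (auto simp: tight_def)
  have "?C = {}" using eq(3) by simp
  then show "{a, b} \<notin> E" if "a \<in> A - B" "b \<in> B - A" for a b
    using that by auto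
qed

lemma critical_Un:
  assumes "critical X" "critical Y" "X \<inter> Y \<noteq> {}" "X \<union> Y \<noteq> V"
  shows "critical (X \<union> Y)"
proof -
  have sub: "X \<subseteq> V" "Y \<subseteq> V" using assms by (auto simp: critical_def)
  have "tight ((V - X) \<inter> (V - Y))"
    using assms sub by (intro tight_uncross) (auto simp: critical_iff_tight)
  moreover have "(V - X) \<inter> (V - Y) = V - (X \<union> Y)" by auto
  ultimately show ?thesis using sub by (simp add: critical_iff_tight)
qed

lemma critical_singleton: "v \<in> V \<Longrightarrow> critical {v}"
proof -
  assume v: "v \<in> V"
  have "{e \<in> E. e \<subseteq> {v}} = {}"
    using edge[of "{v}"] edge[of "{}"] by (auto simp: subset_singleton_iff)
  then have "ind {v} = 0" by (simp add: ind_def)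
  moreover have "{v} \<noteq> V" using card_V_ge_5 by (auto dest: arg_cong[of _ _ card])
  ultimately show ?thesis using v by (auto simp: critical_def)
qed

text \<open>Two or three vertices would need 2 or 4 edges, but have only 1 or 3 pairs.\<close>

lemma critical_card:
  assumes "critical X" "card X \<ge> 2"
  shows "card X \<ge> 4"
proof (rule ccontr)
  assume "\<not> ?thesis"
  then have "card X = 2 \<or> card X = 3" using assms by auto
  then show False using ind_le_choose[of X] assms by (auto simp: critical_def choose_two)
qed

lemma handshake:
  assumes "X \<subseteq> V"
  shows "(\<Sum>x\<in>X. touch {x}) = touch X + ind X"
proof -
  have "card (e \<inter> X) = (if e \<inter> X \<noteq> {} then 1 else 0) + (if e \<subseteq> X then 1 else 0)" if "e \<in> E" for e
  proof -
    obtain x y where "e = {x, y}" "x \<noteq> y" using edge[OF \<open>e \<in> E\<close>] by (auto simp: card_2_iff)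
    then show ?thesis by (cases "x \<in> X"; cases "y \<in> X") auto
  qed
  then have "(\<Sum>e\<in>E. card (e \<inter> X)) =
      (\<Sum>e\<in>E. (if e \<inter> X \<noteq> {} then 1 else 0) + (if e \<subseteq> X then 1 else 0))"
    by (intro sum.cong) auto
  also have "\<dots> = touch X + ind X"
    by (simp add: sum.distrib sum.If_cases touch_def ind_def Int_def)
  finally show ?thesis
    using sum_card_incident[of E X] assms by (simp add: touch_def)
qed

lemma card_neighbours: "card (neighbours G v) = touch {v}"
proof -
  have "bij_betw (\<lambda>u. {u, v}) (neighbours G v) {e \<in> E. e \<inter> {v} \<noteq> {}}"
  proof (rule bij_betw_imageI)
    show "inj_on (\<lambda>u. {u, v}) (neighbours G v)" by (auto simp: inj_on_def doubleton_eq_iff)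
    show "(\<lambda>u. {u, v}) ` neighbours G v = {e \<in> E. e \<inter> {v} \<noteq> {}}"
    proof (intro equalityI subsetI)
      fix e assume "e \<in> {e \<in> E. e \<inter> {v} \<noteq> {}}"
      then obtain u where "e = {v, u}" "e \<in> E" by (auto elim: edgeE)
      then show "e \<in> (\<lambda>u. {u, v}) ` neighbours G v" by (auto simp: neighbours_def insert_commute)
    qed (auto simp: neighbours_def)
  qed
  then show ?thesis by (simp add: bij_betw_same_card touch_def)
qed

lemma neighbours_sub: "neighbours G v \<subseteq> V - {v}"
  using adj by (auto simp: neighbours_def)

lemma finite_neighbours [simp]: "finite (neighbours G v)"
  by (rule finite_sub) (use neighbours_sub in auto)

lemma neighbours_sym: "u \<in> neighbours G v \<longleftrightarrow> v \<in> neighbours G u"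
  by (simp add: neighbours_def insert_commute)

text \<open>The edges lost with \<open>v\<close> are those meeting \<open>A\<close> in
  \<open>v\<close> alone, one for each neighbour outside \<open>A\<close>.\<close>

lemma touch_remove:
  assumes "v \<in> A"
  shows "touch A = touch (A - {v}) + card (neighbours G v - A)"
proof -
  let ?N = "{e \<in> E. e \<inter> A = {v}}"
  have "bij_betw (\<lambda>u. {u, v}) (neighbours G v - A) ?N"
  proof (rule bij_betw_imageI)
    show "inj_on (\<lambda>u. {u, v}) (neighbours G v - A)" by (auto simp: inj_on_def doubleton_eq_iff)
    show "(\<lambda>u. {u, v}) ` (neighbours G v - A) = ?N"
    proof (intro equalityI subsetI)
      fix e assume "e \<in> ?N"
      then have e: "e \<in> E" "e \<inter> A = {v}" by auto
      then obtain u where "e = {v, u}" "u \<noteq> v" using edgeE[of e v] by blast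
      with e show "e \<in> (\<lambda>u. {u, v}) ` (neighbours G v - A)"
        by (auto simp: neighbours_def insert_commute)
    qed (use assms in \<open>auto simp: neighbours_def\<close>)
  qed
  then have "card (neighbours G v - A) = card ?N" by (rule bij_betw_same_card)
  moreover have "card {e \<in> E. e \<inter> A \<noteq> {}} = card {e \<in> E. e \<inter> (A - {v}) \<noteq> {}} + card ?N"
  proof -
    have "{e \<in> E. e \<inter> A \<noteq> {}} = {e \<in> E. e \<inter> (A - {v}) \<noteq> {}} \<union> ?N"
      using assms by blast
    moreover have "{e \<in> E. e \<inter> (A - {v}) \<noteq> {}} \<inter> ?N = {}" by blast
    ultimately show ?thesis by (simp add: card_Un_disjoint)
  qed
  ultimately show ?thesis by (simp add: touch_def)
qed

section \<open>Copies of \<open>K\<^sub>4\<close> and recognition of the three exceptional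
  graphs\<close>

lemma K4_setD:
  assumes "K4_set K"
  shows "K \<subseteq> V" "card K = 4" "finite K" "critical K"
    and "\<And>x y. x \<in> K \<Longrightarrow> y \<in> K \<Longrightarrow> x \<noteq> y \<Longrightarrow> {x, y} \<in> E"
    and "\<And>e. e \<subseteq> K \<Longrightarrow> card e = 2 \<Longrightarrow> e \<in> E"
proof -
  show K: "K \<subseteq> V" "card K = 4" using assms by (auto simp: K4_set_def)
  then show "finite K" by auto
  show "critical K" using K assms card_V_ge_5 by (auto simp: critical_def K4_set_def)
  have "{e \<in> E. e \<subseteq> K} = {e. e \<subseteq> K \<and> card e = 2}"
    using K assms edge
    by (intro card_subset_eq) (auto simp: n_subsets K4_set_def ind_def choose_two intro: finite_subset)
  then show *: "e \<in> E" if "e \<subseteq> K" "card e = 2" for e using that by auto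
  show "{x, y} \<in> E" if "x \<in> K" "y \<in> K" "x \<noteq> y" for x y using that by (intro *) auto
qed

lemma K4_setI:
  assumes "K \<subseteq> V" "card K = 4" "\<And>x y. x \<in> K \<Longrightarrow> y \<in> K \<Longrightarrow> x \<noteq> y \<Longrightarrow> {x, y} \<in> E"
  shows "K4_set K"
proof -
  have "{e \<in> E. e \<subseteq> K} = {e. e \<subseteq> K \<and> card e = 2}"
    using assms(3) edge by (auto simp: card_2_iff)
  then show ?thesis using assms by (simp add: K4_set_def ind_def n_subsets choose_two)
qed

lemma ind_K4_subset:
  assumes "K4_set K" "X \<subseteq> K"
  shows "ind X = card X choose 2"
proof -
  have "{e \<in> E. e \<subseteq> X} = {e. e \<subseteq> X \<and> card e = 2}"
  proof (rule Collect_cong)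
    fix e
    show "e \<in> E \<and> e \<subseteq> X \<longleftrightarrow> e \<subseteq> X \<and> card e = 2"
      using K4_setD(6)[OF assms(1), of e] assms(2) edge[of e] by blast
  qed
  then show ?thesis using assms K4_setD(3)[OF assms(1)]
    by (simp add: ind_def n_subsets finite_subset)
qed

lemma ind_Un: "ind X + ind Y \<le> ind (X \<union> Y) + ind (X \<inter> Y)"
proof -
  have "card {e \<in> E. e \<subseteq> X} + card {e \<in> E. e \<subseteq> Y} =
      card ({e \<in> E. e \<subseteq> X} \<union> {e \<in> E. e \<subseteq> Y}) + card ({e \<in> E. e \<subseteq> X} \<inter> {e \<in> E. e \<subseteq> Y})"
    by (rule card_Un_Int) auto
  moreover have "card ({e \<in> E. e \<subseteq> X} \<union> {e \<in> E. e \<subseteq> Y}) \<le> ind (X \<union> Y)"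
    unfolding ind_def by (rule card_mono) auto
  moreover have "card ({e \<in> E. e \<subseteq> X} \<inter> {e \<in> E. e \<subseteq> Y}) = ind (X \<inter> Y)"
    unfolding ind_def by (rule arg_cong[of _ _ card]) auto
  ultimately show ?thesis by (simp add: ind_def)
qed

text \<open>The map goes from \<open>H\<close> to \<open>G\<close> because the concrete graphs have
  numbered vertices, and a numbering is a function on those numbers.\<close>

lemma graph_isoI:
  assumes "bij_betw f (verts H) V" "(`) f ` edges H = E" "\<And>e. e \<in> edges H \<Longrightarrow> e \<subseteq> verts H"
  shows "graph_iso G H"
proof (rule graph_iso_sym[OF _ assms(3)])
  show "graph_iso H G" unfolding graph_iso_def using assms(1,2) by blast
qed

lemma K4_set_if_iso:
  assumes "X \<subseteq> V" "graph_iso (X, {e \<in> E. e \<subseteq> X}) K4"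
  shows "K4_set X"
proof -
  obtain f where f: "bij_betw f X {1, 2, 3, 4::nat}"
      "(`) f ` {e \<in> E. e \<subseteq> X} = {e. e \<subseteq> {1, 2, 3, 4} \<and> card e = 2}"
    using assms(2) unfolding graph_iso_def K4_def complete_graph_def fst_conv snd_conv by blast
  have X: "card X = 4" using bij_betw_same_card[OF f(1)] by simp
  have "card {e. e \<subseteq> {1, 2, 3, 4::nat} \<and> card e = 2} = 6" by (simp add: n_subsets choose_two)
  moreover have "card ((`) f ` {e \<in> E. e \<subseteq> X}) \<le> ind X"
    unfolding ind_def by (rule card_image_le) simp
  ultimately have "6 \<le> ind X" unfolding f(2) by simp
  then show ?thesis using ind_le_choose[OF assms(1)] X assms(1) by (simp add: K4_set_def choose_two)
qed

text \<open>Nine of the ten pairs are edges, so exactly one pair \<open>{a, b}\<close> is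
  missing.\<close>

lemma K5_minus_edge_if_card_5:
  assumes "card V = 5"
  shows "graph_iso G K5_minus_edge"
proof -
  let ?P = "{e. e \<subseteq> V \<and> card e = 2}"
  have P: "finite ?P" "card ?P = 10" using assms by (auto simp: n_subsets choose_two)
  have "E \<subseteq> ?P" "card E = 9" using edge card_E assms by auto
  then have "card (?P - E) = 1" using P by (simp add: card_Diff_subset)
  then obtain e where e: "?P - E = {e}" by (auto simp: card_1_singleton_iff)
  then have "e \<subseteq> V" "card e = 2" by auto
  then obtain a b where ab: "e = {a, b}" "a \<noteq> b" by (auto simp: card_2_iff)
  have "card (V - e) = 3" using \<open>e \<subseteq> V\<close> \<open>card e = 2\<close> assms by (simp add: card_Diff_subset)
  then obtain c d g where cd: "V - e = {c, d, g}" "c \<noteq> d" "c \<noteq> g" "d \<noteq> g"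
    by (auto simp: card_3_iff)
  have V: "V = {a, b, c, d, g}" using cd \<open>e \<subseteq> V\<close> ab by auto
  have dist: "distinct [a, b, c, d, g]" using cd ab by auto
  define f where "f n = [a, b, c, d, g] ! (n - 1)" for n :: nat
  have f: "f 1 = a" "f 2 = b" "f 3 = c" "f 4 = d" "f 5 = g" by (simp_all add: f_def)
  have inj: "inj_on f {1, 2, 3, 4, 5}" using dist f by (auto simp: inj_on_def)
  have im: "f ` {1, 2, 3, 4, 5} = V" using f V by auto
  have "(`) f ` edges K5_minus_edge =
      (`) f ` {e. e \<subseteq> {1, 2, 3, 4, 5} \<and> card e = 2} - (`) f ` {{1, 2}}"
    unfolding K5_minus_edge_def delete_edges_def complete_graph_def fst_conv snd_conv
    by (rule inj_on_image_set_diff[OF inj_on_image_Pow[OF inj]]) auto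
  also have "\<dots> = ?P - {e}" unfolding image_pairs[OF inj] im using f ab by simp
  also have "\<dots> = E" using e \<open>E \<subseteq> ?P\<close> by auto
  finally show ?thesis
    using inj im by (intro graph_isoI[of f])
      (auto simp: bij_betw_def K5_minus_edge_def delete_edges_def complete_graph_def)
qed

text \<open>The union carries at least 6 + 6 - 1 = 11 edges on 6 vertices, too many for a proper
  vertex set. Hence it is all of \<open>V\<close>, and 11 being the total number of edges, there are
  no others.\<close>

lemma H1_if_K4s:
  assumes K: "K4_set K" "K4_set K'" and cap: "card (K \<inter> K') = 2"
  shows "graph_iso G H1"
proof -
  note [simp] = K4_setD(3)[OF K(1)] K4_setD(3)[OF K(2)]
  have c: "card K = 4" "card K' = 4" using K by (auto simp: K4_set_def)
  obtain x y where xy: "K \<inter> K' = {x, y}" "x \<noteq> y" using cap by (auto simp: card_2_iff)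
  have "card (K - K') = 2" "card (K' - K) = 2"
    using c cap by (simp_all add: card_Diff_subset_Int Int_commute)
  then obtain a b p q where ab: "K - K' = {a, b}" "a \<noteq> b" and pq: "K' - K = {p, q}" "p \<noteq> q"
    unfolding card_2_iff by blast
  have KK: "K = {a, b, x, y}" "K' = {x, y, p, q}" using ab pq xy by auto
  have dist: "distinct [a, b, x, y, p, q]" using ab pq xy by auto
  have cU: "card (K \<union> K') = 6" using dist unfolding KK by (auto simp: card_insert_if)
  have "ind (K \<union> K') + ind (K \<inter> K') \<ge> 12" using ind_Un[of K K'] K by (simp add: K4_set_def)
  moreover have "ind (K \<inter> K') = 1" using ind_K4_subset[OF K(1), of "K \<inter> K'"] cap by (simp add: choose_two)
  ultimately have i: "ind (K \<union> K') \<ge> 11" by simp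
  have V: "K \<union> K' = V"
  proof (rule ccontr)
    assume "K \<union> K' \<noteq> V"
    then have "ind (K \<union> K') + 2 \<le> 2 * card (K \<union> K')"
      using K4_setD(1)[OF K(1)] K4_setD(1)[OF K(2)] xy by (intro sparse) auto
    then show False using i cU by simp
  qed
  let ?P = "\<lambda>K. {e. e \<subseteq> K \<and> card e = 2}"
  have "?P K \<inter> ?P K' = {e. e \<subseteq> K \<inter> K' \<and> card e = 2}" by auto
  then have "card (?P K \<union> ?P K') = 11"
    using card_Un_Int[of "?P K" "?P K'"] n_subsets[of "K \<inter> K'" 2] c cap
    by (simp add: n_subsets choose_two)
  moreover have "?P K \<union> ?P K' \<subseteq> E" using K4_setD(6)[OF K(1)] K4_setD(6)[OF K(2)] by auto
  moreover have "card E = 11" using card_E cU V by simp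
  ultimately have E: "?P K \<union> ?P K' = E" by (intro card_subset_eq) auto
  define f where "f n = [a, b, x, y, p, q] ! (n - 1)" for n :: nat
  have f: "f 1 = a" "f 2 = b" "f 3 = x" "f 4 = y" "f 5 = p" "f 6 = q" by (simp_all add: f_def)
  have inj: "inj_on f {1, 2, 3, 4, 5, 6}" using dist f by (auto simp: inj_on_def)
  have inj': "inj_on f {1, 2, 3, 4}" "inj_on f {3, 4, 5, 6}" using dist f by (auto simp: inj_on_def)
  have "(`) f ` edges H1 = ?P (f ` {1, 2, 3, 4}) \<union> ?P (f ` {3, 4, 5, 6})"
    unfolding H1_def graph_union_def complete_graph_def
    by (simp only: snd_conv image_Un image_pairs[OF inj'(1)] image_pairs[OF inj'(2)])
  moreover have "f ` {1, 2, 3, 4} = K" "f ` {3, 4, 5, 6} = K'" using f KK by auto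
  ultimately have "(`) f ` edges H1 = E" using E by simp
  moreover have "verts H1 = {1, 2, 3, 4, 5, 6}"
    by (auto simp: H1_def graph_union_def complete_graph_def)
  moreover have "f ` {1, 2, 3, 4, 5, 6} = V" using f KK V by auto
  ultimately show ?thesis
    using inj by (intro graph_isoI[of f]) (auto simp: bij_betw_def H1_def graph_union_def complete_graph_def)
qed

text \<open>There are 7 vertices and 13 edges, of which the two copies account for 12. The remaining
  edge lies in neither copy, so it joins them and avoids their common vertex.\<close>

lemma H2_if_K4s:
  assumes K: "K4_set K" "K4_set K'" and cap: "card (K \<inter> K') = 1" and V: "K \<union> K' = V"
  shows "graph_iso G H2"
proof -
  note [simp] = K4_setD(3)[OF K(1)] K4_setD(3)[OF K(2)]
  have c: "card K = 4" "card K' = 4" using K by (auto simp: K4_set_def)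
  let ?P = "\<lambda>K. {e. e \<subseteq> K \<and> card e = 2}"
  obtain t where t: "K \<inter> K' = {t}" using cap by (auto simp: card_1_singleton_iff)
  have "?P K \<inter> ?P K' = {}"
  proof (rule equals0I)
    fix e assume "e \<in> ?P K \<inter> ?P K'"
    then have "e \<subseteq> {t}" "card e = 2" using t by auto
    then show False using card_mono[of "{t}" e] by simp
  qed
  then have "card (?P K \<union> ?P K') = card (?P K) + card (?P K')" by (intro card_Un_disjoint) auto
  then have cP: "card (?P K \<union> ?P K') = 12" using c by (simp add: n_subsets choose_two)
  have PE: "?P K \<union> ?P K' \<subseteq> E" using K4_setD(6)[OF K(1)] K4_setD(6)[OF K(2)] by auto
  have "card V = 7" using card_Un_Int[of K K'] c cap V by simp
  then have "card E = 13" using card_E by simp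
  then have "card (E - (?P K \<union> ?P K')) = 1" using cP PE by (simp add: card_Diff_subset)
  then obtain e where e: "E - (?P K \<union> ?P K') = {e}" by (auto simp: card_1_singleton_iff)
  then have "e \<in> E" "\<not> e \<subseteq> K" "\<not> e \<subseteq> K'" using edge by blast+
  obtain u w where uw: "e = {u, w}" "u \<in> K \<union> K'" "w \<in> K \<union> K'"
    using edge[OF \<open>e \<in> E\<close>] V by (auto simp: card_2_iff)
  obtain x y where xy: "e = {x, y}" "x \<in> K - K'" "y \<in> K' - K"
  proof (cases "u \<in> K")
    case True
    then show ?thesis using that[of u w] uw \<open>\<not> e \<subseteq> K\<close> \<open>\<not> e \<subseteq> K'\<close> by blast
  next
    case False
    then show ?thesis using that[of w u] uw \<open>\<not> e \<subseteq> K'\<close> by blast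
  qed
  have tx: "{t, x} \<subseteq> K" "{t, y} \<subseteq> K'" "t \<noteq> x" "t \<noteq> y" using t xy by auto
  have "card (K - {t, x}) = 2" "card (K' - {t, y}) = 2"
    using card_Diff_subset[OF _ tx(1)] card_Diff_subset[OF _ tx(2)] tx(3,4) c by simp_all
  then obtain b d p q where bd: "K - {t, x} = {b, d}" "b \<noteq> d" and pq: "K' - {t, y} = {p, q}" "p \<noteq> q"
    unfolding card_2_iff by blast
  have "K = {t, x} \<union> {b, d}" "K' = {t, y} \<union> {p, q}" using tx(1,2) bd(1) pq(1) by blast+
  then have KK: "K = {x, b, d, t}" "K' = {t, p, q, y}" by blast+
  have "b \<in> K - {t, x}" "d \<in> K - {t, x}" "p \<in> K' - {t, y}" "q \<in> K' - {t, y}"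
    unfolding bd(1) pq(1) by simp_all
  then have "b \<noteq> t \<and> b \<noteq> x" "d \<noteq> t \<and> d \<noteq> x" "p \<noteq> t \<and> p \<noteq> y" "q \<noteq> t \<and> q \<noteq> y"
    and "b \<notin> K'" "d \<notin> K'" "p \<in> K'" "q \<in> K'" "x \<notin> K'" "y \<in> K'" using t xy(2,3) by blast+
  then have "x \<noteq> b" "x \<noteq> d" "x \<noteq> p" "x \<noteq> q" "x \<noteq> y" "b \<noteq> p" "b \<noteq> q" "b \<noteq> y" "d \<noteq> p" "d \<noteq> q"
    "d \<noteq> y" by blast+
  then have dist: "distinct [x, b, d, t, p, q, y]"
    using bd(2) pq(2) tx(3,4) \<open>b \<noteq> t \<and> b \<noteq> x\<close> \<open>d \<noteq> t \<and> d \<noteq> x\<close> \<open>p \<noteq> t \<and> p \<noteq> y\<close> \<open>q \<noteq> t \<and> q \<noteq> y\<close>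
    by auto
  have "insert e X = E" if "E - X = {e}" "X \<subseteq> E" for X using that by blast
  from this[OF e PE] have E: "insert {x, y} (?P K \<union> ?P K') = E" unfolding xy(1) .
  define f where "f n = [x, b, d, t, p, q, y] ! (n - 1)" for n :: nat
  have f: "f 1 = x" "f 2 = b" "f 3 = d" "f 4 = t" "f 5 = p" "f 6 = q" "f 7 = y"
    by (simp_all add: f_def)
  have inj: "inj_on f {1, 2, 3, 4, 5, 6, 7}" using dist f by (auto simp: inj_on_def)
  have inj': "inj_on f {1, 2, 3, 4}" "inj_on f {4, 5, 6, 7}" using dist f by (auto simp: inj_on_def)
  have "(`) f ` edges H2 = insert {f 1, f 7} (?P (f ` {1, 2, 3, 4}) \<union> ?P (f ` {4, 5, 6, 7}))"
    unfolding H2_def add_edge_def graph_union_def complete_graph_def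
    by (simp only: snd_conv image_Un image_insert image_empty
        image_pairs[OF inj'(1)] image_pairs[OF inj'(2)])
  moreover have "f ` {1, 2, 3, 4} = K" "f ` {4, 5, 6, 7} = K'" using f KK by auto
  ultimately have "(`) f ` edges H2 = E" using E f by simp
  moreover have "verts H2 = {1, 2, 3, 4, 5, 6, 7}"
    by (auto simp: H2_def add_edge_def graph_union_def complete_graph_def)
  moreover have "f ` {1, 2, 3, 4, 5, 6, 7} = V" using f KK V by auto
  ultimately show ?thesis
    using inj by (intro graph_isoI[of f])
      (auto simp: bij_betw_def H2_def add_edge_def graph_union_def complete_graph_def)
qed

section \<open>Tight sets around the neighbours of an inadmissible node\<close>

lemma vert_degree_touch: "vert_degree G v = touch {v}"
  by (simp add: vert_degree_def touch_def)

text \<open>The reduced graph has the right number of edges, so some proper edge set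
  \<open>F\<close> violates sparsity. Its vertex set \<open>X\<close> is the witness: without the
  new edge, \<open>F\<close> still has at least \<open>2 * card X - 2\<close> edges.\<close>

lemma inadmissible_pair:
  assumes v: "node G v" "\<not> admissible_node G v"
    and xy: "x \<in> neighbours G v" "y \<in> neighbours G v" "x \<noteq> y" "{x, y} \<notin> E"
  shows "\<exists>X. critical X \<and> X \<subset> V - {v} \<and> x \<in> X \<and> y \<in> X"
proof -
  let ?H = "add_edge (delete_vertex G v) {x, y}"
  let ?E = "{e \<in> E. v \<notin> e}"
  have vV: "v \<in> V" and deg: "card {e \<in> E. v \<in> e} = 3"
    using v(1) by (auto simp: node_def vert_degree_def)
  have xyV: "x \<in> V - {v}" "y \<in> V - {v}" using xy neighbours_sub by blast+
  have EH: "edges ?H = insert {x, y} ?E" and VH: "verts ?H = V - {v}"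
    by (simp_all add: add_edge_def delete_vertex_def)
  have "E = ?E \<union> {e \<in> E. v \<in> e}" "?E \<inter> {e \<in> E. v \<in> e} = {}" by blast+
  then have "card E = card ?E + 3" using deg card_Un_disjoint[of ?E "{e \<in> E. v \<in> e}"] by simp
  moreover have "{x, y} \<notin> ?E" using xy(4) by blast
  ultimately have cEH: "card (edges ?H) + 2 = card E" unfolding EH by simp
  have cVH: "card (verts ?H) + 1 = card V" unfolding VH using vV card_V_ge_5 by simp
  have "\<not> M22_circuit ?H"
    using v xy unfolding admissible_node_def one_reduction_def by blast
  moreover have "simple_graph ?H"
    unfolding simple_graph_def EH VH using edge xyV xy(3) by auto
  moreover have "card (edges ?H) + 1 = 2 * card (verts ?H)"
    using cEH cVH card_E by linarith
  ultimately obtain F where F: "F \<noteq> {}" "F \<subset> edges ?H" "\<not> card F + 2 \<le> 2 * card (\<Union>F)"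
    unfolding M22_circuit_def by blast
  \<comment> \<open>Otherwise \<open>F\<close> would be a proper edge set of \<open>G\<close>
    itself, missing the edges at \<open>v\<close>, and the circuit bound would apply.\<close>
  have xyF: "{x, y} \<in> F"
  proof (rule ccontr)
    assume "{x, y} \<notin> F"
    then have "F \<subseteq> ?E" using F(2) unfolding EH by blast
    moreover have "?E \<noteq> E" using deg by (metis (no_types, lifting) card.empty Collect_empty_eq
          mem_Collect_eq zero_neq_numeral)
    ultimately have "F \<subset> E" by blast
    then show False using F circuit unfolding M22_circuit_def by blast
  qed
  define X where "X = \<Union>F"
  have XV: "X \<subseteq> V - {v}" using F(2) edge xyV unfolding X_def EH by blast
  have fX: "finite X" using XV by (meson finite_Diff finite_V finite_subset)
  have "F - {{x, y}} \<subseteq> {e \<in> E. e \<subseteq> X}" using F(2) unfolding X_def EH by blast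
  then have "card (F - {{x, y}}) \<le> ind X" unfolding ind_def by (intro card_mono) auto
  moreover have "F \<subseteq> insert {x, y} E" using F(2) unfolding EH by blast
  then have "finite F" by (rule finite_subset) simp
  ultimately have "card F \<le> ind X + 1" using xyF by simp
  then have ge: "ind X + 2 \<ge> 2 * card X" using F(3) unfolding X_def by linarith
  have xyX: "x \<in> X" "y \<in> X" using xyF unfolding X_def by blast+
  have "X \<subset> V" using XV vV by blast
  then have "critical X" using sparse[of X] ge xyX unfolding critical_def by fastforce
  \<comment> \<open>If \<open>F\<close> covered all vertices of the reduced graph, the violated
    bound would make it as large as the whole edge set, although it is proper.\<close>
  moreover have "X \<noteq> V - {v}"
  proof
    assume "X = V - {v}"
    then have "card X + 1 = card V" using cVH VH by simp
    moreover have "card F < card (edges ?H)"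
      using F(2) unfolding EH by (intro psubset_card_mono) auto
    ultimately show False using F(3) cEH card_E unfolding X_def by linarith
  qed
  ultimately show ?thesis using XV xyX by blast
qed

text \<open>The set \<open>C\<close> is \<open>V - X - {v}\<close> for the critical set \<open>X\<close> that blocks the 1-reduction adding \<open>{x, y}\<close>.\<close>

lemma inadmissible_tight:
  assumes v: "node G v" "\<not> admissible_node G v"
    and N: "neighbours G v = {x, y, z}" "distinct [x, y, z]" and xy: "{x, y} \<notin> E"
  shows "\<exists>C. tight C \<and> v \<notin> C \<and> C \<inter> neighbours G v = {z}"
proof -
  obtain X where X: "critical X" "X \<subset> V - {v}" "x \<in> X" "y \<in> X"
    using inadmissible_pair[OF v, of x y] N xy by auto
  define B where "B = V - X"
  have B: "tight B" "v \<in> B" "x \<notin> B" "y \<notin> B" "B - {v} \<noteq> {}" "B \<subset> V"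
    using X critical_iff_tight[of X] v(1) unfolding B_def node_def critical_def by auto
  have fB: "finite B" using B(6) by auto
  \<comment> \<open>Deleting \<open>v\<close> lowers the least possible \<open>touch\<close> by 2,
    so at most two neighbours lie outside \<open>B\<close>. Since \<open>x\<close> and
    \<open>y\<close> do, \<open>z\<close> lies inside, and \<open>B - {v}\<close> is tight
    again.\<close>
  have "touch (B - {v}) \<ge> 2 * card (B - {v}) + 1" using B by (intro touch_ge) auto
  moreover have tr: "touch B = touch (B - {v}) + card (neighbours G v - B)"
    using B by (intro touch_remove)
  moreover have cB: "card B = card (B - {v}) + 1" using card.remove[OF fB B(2)] by simp
  moreover have tB: "touch B = 2 * card B + 1" using B(1) by (simp add: tight_def)
  ultimately have le: "card (neighbours G v - B) \<le> 2" by linarith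
  have z: "z \<in> B"
  proof (rule ccontr)
    assume "z \<notin> B"
    then have "neighbours G v - B = {x, y, z}" unfolding N(1) using B(3,4) by blast
    then show False using le N(2) by simp
  qed
  then have "neighbours G v - B = {x, y}" unfolding N(1) using B(3,4) N(2) by auto
  then have "card (neighbours G v - B) = 2" using N(2) by simp
  then have "tight (B - {v})"
    using B(5,6) tB tr cB unfolding tight_def by auto
  moreover have "z \<noteq> v" using N(1) neighbours_sub by blast
  then have "(B - {v}) \<inter> neighbours G v = {z}" unfolding N(1) using B(3,4) z by blast
  ultimately show ?thesis by blast
qed

text \<open>Exactly two new edges are met, which matches the increase of
  \<open>2 * card A + 1\<close>.\<close>

lemma tight_insert:
  assumes "tight A" "v \<notin> A" "v \<in> V" "card (neighbours G v - A) = 2" "insert v A \<noteq> V"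
  shows "tight (insert v A)"
proof -
  have "neighbours G v - insert v A = neighbours G v - A" using neighbours_sub by blast
  then have "touch (insert v A) = touch A + 2"
    using touch_remove[of v "insert v A"] assms(2,4) by simp
  then show ?thesis using assms by (auto simp: tight_def)
qed

text \<open>Adding \<open>v\<close> keeps both sets tight; they then share \<open>v\<close> and miss
  \<open>y\<close>, so they uncross. This excludes the edge between \<open>x\<close> and
  \<open>z\<close>. A nonempty \<open>A \<inter> C\<close> would gain three edges on adding
  \<open>v\<close>, one too many for the tight intersection.\<close>

lemma tight_at_neighbours_disjoint:
  assumes A: "tight A" "v \<notin> A" "A \<inter> neighbours G v = {x}"
    and C: "tight C" "v \<notin> C" "C \<inter> neighbours G v = {z}"
    and N: "neighbours G v = {x, y, z}" "distinct [x, y, z]" and v: "v \<in> V"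
  shows "A \<inter> C = {}" "{x, z} \<notin> E"
proof -
  have nv: "v \<notin> neighbours G v" using neighbours_sub by blast
  have mem: "x \<in> neighbours G v" "y \<in> neighbours G v" "z \<in> neighbours G v" using N(1) by simp_all
  have ne: "x \<noteq> y" "x \<noteq> z" "y \<noteq> z" using N(2) by simp_all
  have A': "w \<in> A \<longleftrightarrow> w = x" and C': "w \<in> C \<longleftrightarrow> w = z" if "w \<in> neighbours G v" for w
    using A(3) C(3) that by blast+
  have y: "y \<in> V" "y \<notin> A" "y \<notin> C" "y \<noteq> v"
    using A'[OF mem(2)] C'[OF mem(2)] ne mem nv neighbours_sub by blast+
  have x: "x \<in> A" "x \<notin> C" "x \<noteq> v" and z: "z \<in> C" "z \<notin> A" "z \<noteq> v"
    using A'[OF mem(1)] C'[OF mem(1)] A'[OF mem(3)] C'[OF mem(3)] ne mem nv by blast+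
  have "neighbours G v - A = {y, z}" unfolding N(1) using y(2) x(1) z(2) by blast
  then have tA: "tight (insert v A)"
    using A(1,2) y v ne by (intro tight_insert) auto
  have "neighbours G v - C = {x, y}" unfolding N(1) using y(3) x(2) z(1) by blast
  then have tC: "tight (insert v C)"
    using C(1,2) y v ne by (intro tight_insert) auto
  have un: "insert v A \<union> insert v C \<noteq> V" using y by blast
  have int: "insert v A \<inter> insert v C \<noteq> {}" by blast
  show "{x, z} \<notin> E"
    using tight_uncross(3)[OF tA tC int un, of x z] x z by blast
  have eq: "insert v A \<inter> insert v C = insert v (A \<inter> C)" by blast
  have t: "tight (insert v (A \<inter> C))"
    using tight_uncross(1)[OF tA tC int un] unfolding eq .
  show "A \<inter> C = {}"
  proof (rule ccontr)
    assume meet: "A \<inter> C \<noteq> {}"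
    have "A \<inter> C \<subset> V" using A(1) by (auto simp: tight_def)
    then have "touch (A \<inter> C) \<ge> 2 * card (A \<inter> C) + 1" using meet by (intro touch_ge)
    moreover have "neighbours G v - insert v (A \<inter> C) = {x, y, z}"
      unfolding N(1) using x y z by blast
    then have "touch (insert v (A \<inter> C)) = touch (A \<inter> C) + 3"
      using touch_remove[of v "insert v (A \<inter> C)"] A(2) ne by simp
    moreover have "finite (A \<inter> C)" using A(1) by (auto simp: tight_def)
    ultimately show False using t A(2) by (simp add: tight_def)
  qed
qed

section \<open>Leaves in the forest induced by nodes\<close>

lemma card_incident_in:
  "card {e \<in> E. e \<subseteq> N \<and> v \<in> e} = card (neighbours G v \<inter> N)" if "v \<in> N"
proof -
  have "bij_betw (\<lambda>u. {u, v}) (neighbours G v \<inter> N) {e \<in> E. e \<subseteq> N \<and> v \<in> e}"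
  proof (rule bij_betw_imageI)
    show "inj_on (\<lambda>u. {u, v}) (neighbours G v \<inter> N)" by (auto simp: inj_on_def doubleton_eq_iff)
    show "(\<lambda>u. {u, v}) ` (neighbours G v \<inter> N) = {e \<in> E. e \<subseteq> N \<and> v \<in> e}"
    proof (intro equalityI subsetI)
      fix e assume "e \<in> {e \<in> E. e \<subseteq> N \<and> v \<in> e}"
      then have e: "e \<in> E" "e \<subseteq> N" "v \<in> e" by auto
      then obtain u where "e = {v, u}" using edgeE[of e v] by blast
      with e show "e \<in> (\<lambda>u. {u, v}) ` (neighbours G v \<inter> N)"
        by (auto simp: neighbours_def insert_commute)
    qed (use that in \<open>auto simp: neighbours_def\<close>)
  qed
  then show ?thesis by (simp add: bij_betw_same_card)
qed

lemma sum_inner_degrees: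
  assumes "N \<subseteq> V"
  shows "(\<Sum>v\<in>N. card (neighbours G v \<inter> N)) = 2 * ind N"
proof -
  let ?F = "{e \<in> E. e \<subseteq> N}"
  have "(\<Sum>v\<in>N. card (neighbours G v \<inter> N)) = (\<Sum>v\<in>N. card {e \<in> ?F. v \<in> e})"
    by (rule sum.cong) (simp_all add: card_incident_in[symmetric] conj_assoc)
  also have "\<dots> = (\<Sum>e\<in>?F. card (e \<inter> N))" by (rule sum_card_incident) (use assms in auto)
  also have "\<dots> = (\<Sum>e\<in>?F. 2)" by (rule sum.cong) (use edge in \<open>auto simp: Int_absorb2\<close>)
  finally show ?thesis by (simp add: ind_def)
qed

text \<open>The degree sum \<open>3 * card N\<close> equals \<open>touch N + ind N\<close>, and
  \<open>touch N\<close> is at least \<open>2 * card N + 1\<close>. Applied to all subsets, this is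
  the forest property.\<close>

lemma ind_nodes:
  assumes "N \<noteq> {}" "N \<subseteq> V" "\<And>v. v \<in> N \<Longrightarrow> touch {v} = 3"
  shows "ind N < card N"
proof -
  have "touch N + ind N = 3 * card N" using handshake[OF assms(2)] assms(3) by simp
  moreover have "touch N \<ge> 2 * card N + 1"
  proof (cases "N = V")
    case True
    \<comment> \<open>A circuit in which every vertex is a node would have only two
      vertices.\<close>
    have "3 * card V = 2 * card E" using \<open>touch N + ind N = _\<close> True ind_V touch_V by simp
    then show ?thesis using card_E card_V_ge_5 by linarith
  qed (use assms touch_ge in auto)
  ultimately show ?thesis by linarith
qed

lemma node_leaf:
  assumes "N \<noteq> {}" "N \<subseteq> V" "\<And>v. v \<in> N \<Longrightarrow> touch {v} = 3"
  shows "\<exists>u\<in>N. card (neighbours G u \<inter> N) \<le> 1"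
proof (rule ccontr)
  assume "\<not> ?thesis"
  then have "(\<Sum>v\<in>N. 2) \<le> (\<Sum>v\<in>N. card (neighbours G v \<inter> N))"
    by (intro sum_mono) auto
  then show False using sum_inner_degrees[OF assms(2)] ind_nodes[OF assms] by simp
qed

text \<open>If \<open>u\<close> were the only leaf, the degree sum would force it to be isolated. A
  leaf of \<open>N - {u}\<close> is then not adjacent to \<open>u\<close> and is a second leaf of
  \<open>N\<close>.\<close>

lemma two_node_leaves:
  assumes "card N \<ge> 2" "N \<subseteq> V" "\<And>v. v \<in> N \<Longrightarrow> touch {v} = 3"
  shows "\<exists>u\<in>N. \<exists>w\<in>N. u \<noteq> w \<and> card (neighbours G u \<inter> N) \<le> 1 \<and> card (neighbours G w \<inter> N) \<le> 1"
proof (rule ccontr)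
  assume none: "\<not> ?thesis"
  have ne: "N \<noteq> {}" and fin: "finite N" using assms(1,2) by auto
  obtain u where u: "u \<in> N" "card (neighbours G u \<inter> N) \<le> 1"
    using node_leaf[OF ne assms(2,3)] by blast
  have "card (neighbours G w \<inter> N) \<ge> 2" if "w \<in> N - {u}" for w
    using none u that by (metis Diff_iff insertI1 not_less_eq_eq numeral_2_eq_2 One_nat_def)
  then have "(\<Sum>v\<in>N - {u}. 2) \<le> (\<Sum>v\<in>N - {u}. card (neighbours G v \<inter> N))"
    by (intro sum_mono)
  then have "2 * card (N - {u}) \<le> (\<Sum>v\<in>N - {u}. card (neighbours G v \<inter> N))" by simp
  moreover have "(\<Sum>v\<in>N. card (neighbours G v \<inter> N)) =
      card (neighbours G u \<inter> N) + (\<Sum>v\<in>N - {u}. card (neighbours G v \<inter> N))"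
    by (rule sum.remove[OF fin u(1)])
  moreover have "card N = card (N - {u}) + 1" using card.remove[OF fin u(1)] by simp
  ultimately have "card (neighbours G u \<inter> N) = 0"
    using sum_inner_degrees[OF assms(2)] ind_nodes[OF ne assms(2,3)] by linarith
  then have iso: "neighbours G u \<inter> N = {}"
    using card_0_eq[of "neighbours G u \<inter> N"] fin by blast
  have "card (N - {u}) \<noteq> 0" using assms(1) \<open>card N = _\<close> by linarith
  then have "N - {u} \<noteq> {}" by (metis card.empty)
  then obtain w where w: "w \<in> N - {u}" "card (neighbours G w \<inter> (N - {u})) \<le> 1"
    using node_leaf[of "N - {u}"] assms(2,3) by blast
  have "u \<notin> neighbours G w" using iso w(1) neighbours_sym[of u w] by blast
  then have "neighbours G w \<inter> N = neighbours G w \<inter> (N - {u})" by blast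
  then show False using none u w by (metis DiffD1 DiffD2 insertI1)
qed

end

section \<open>Consequences of the absence of nontrivial separations\<close>

locale reduced_circuit = circuit +
  assumes not_K5_minus_edge: "\<not> graph_iso G K5_minus_edge"
    and not_H1: "\<not> graph_iso G H1"
    and not_H2: "\<not> graph_iso G H2"
    and no_2_sep: "\<not> (\<exists>F1 F2. nontrivial_two_vertex_separation G F1 F2)"
    and no_3_sep: "\<not> (\<exists>F1 F2 S. nontrivial_three_edge_separation G F1 F2 S)"
begin

text \<open>The working form of \<open>no_2_sep\<close>: two vertex sets overlapping in two
  vertices, with no edge between their differences, form a separation.\<close>

lemma two_sep:
  assumes V: "V1 \<union> V2 = V" and "card (V1 \<inter> V2) = 2" "V1 - V2 \<noteq> {}" "V2 - V1 \<noteq> {}"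
    and no: "\<And>a b. a \<in> V1 - V2 \<Longrightarrow> b \<in> V2 - V1 \<Longrightarrow> {a, b} \<notin> E"
  shows "K4_set V1 \<or> K4_set V2"
proof -
  let ?F = "\<lambda>X. (X, {e \<in> E. e \<subseteq> X})"
  have "e \<subseteq> V1 \<or> e \<subseteq> V2" if "e \<in> E" for e
  proof -
    obtain a b where "e = {a, b}" using edge[OF \<open>e \<in> E\<close>] by (auto simp: card_2_iff)
    then show ?thesis using no[of a b] no[of b a] that edge[OF that] V by (auto simp: insert_commute)
  qed
  then have "{e \<in> E. e \<subseteq> V1} \<union> {e \<in> E. e \<subseteq> V2} = E" by auto
  then have "two_vertex_separation G (?F V1) (?F V2)"
    using assms by (auto simp: two_vertex_separation_def induced_subgraph_def graph_union_def prod_eq_iff)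
  then have "graph_iso (?F V1) K4 \<or> graph_iso (?F V2) K4"
    using no_2_sep unfolding nontrivial_two_vertex_separation_def by blast
  then show ?thesis using K4_set_if_iso V by blast
qed

text \<open>Counting leaves exactly three edges between \<open>X\<close> and \<open>Y\<close>. If
  they are pairwise disjoint, they give a nontrivial 3-edge-separation. If two share an end
  \<open>a\<close>, then \<open>a\<close> and an end \<open>d\<close> of the third on the other side
  give a 2-vertex-separation with at least five vertices on each side.\<close>

lemma critical_disjoint:
  assumes X: "critical X" and Y: "critical Y" and dis: "X \<inter> Y = {}" and V: "X \<union> Y = V"
  shows "card X = 1 \<or> card Y = 1"
proof (rule ccontr)
  \<comment> \<open>The case of two crossing edges with a common end in \<open>X\<close>, stated for
    arbitrary sets so that it also serves with \<open>X\<close> and \<open>Y\<close>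
    exchanged.\<close>
  have no: False
    if X: "critical X" "card X \<ge> 4" and Y: "critical Y" "card Y \<ge> 4" and dis: "X \<inter> Y = {}" and V: "X \<union> Y = V"
      and S: "{e \<in> E. \<not> e \<subseteq> X \<and> \<not> e \<subseteq> Y} \<subseteq> {e, f, g}" "g \<in> E" "\<not> g \<subseteq> X" "\<not> g \<subseteq> Y"
      and a: "a \<in> X" "a \<in> e" "a \<in> f" for X Y e f g a
  proof -
    have fin: "finite X" "finite Y" using X Y by (auto simp: critical_def)
    have sub: "X \<subseteq> V" "Y \<subseteq> V" using V by auto
    obtain d where d: "d \<in> Y" "d \<in> g"
      using S(2-4) edge[of g] V by blast
    have "K4_set (insert d X) \<or> K4_set (insert a Y)"
    proof (rule two_sep)
      have "insert d X \<inter> insert a Y = {a, d}" using a d dis by auto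
      then show "card (insert d X \<inter> insert a Y) = 2" using a d dis by (auto simp: card_insert_if)
      have "insert d X - insert a Y = X - {a}" using a d dis by auto
      moreover have "card (X - {a}) > 0" using X a fin by simp
      ultimately show "insert d X - insert a Y \<noteq> {}" by (metis card.empty less_irrefl)
      have "insert a Y - insert d X = Y - {d}" using a d dis by auto
      moreover have "card (Y - {d}) > 0" using Y d fin by simp
      ultimately show "insert a Y - insert d X \<noteq> {}" by (metis card.empty less_irrefl)
    next
      fix x y assume xy: "x \<in> insert d X - insert a Y" "y \<in> insert a Y - insert d X"
      show "{x, y} \<notin> E"
      proof
        assume "{x, y} \<in> E"
        then have "{x, y} \<in> {e, f, g}" using xy S(1) dis by blast
        then show False using xy a d dis by auto
      qed
    qed (use a d V in auto)
    then have "card (insert d X) = 4 \<or> card (insert a Y) = 4" by (auto simp: K4_set_def)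
    moreover have "d \<notin> X" "a \<notin> Y" using a d dis by auto
    ultimately show False using X Y fin by simp
  qed
  assume "\<not> (card X = 1 \<or> card Y = 1)"
  moreover have fin: "finite X" "finite Y" "X \<noteq> {}" "Y \<noteq> {}" using X Y by (auto simp: critical_def)
  moreover have "card X \<noteq> 0" "card Y \<noteq> 0" using fin by auto
  ultimately have "card X \<ge> 2" "card Y \<ge> 2" by linarith+
  then have c4: "card X \<ge> 4" "card Y \<ge> 4" using critical_card X Y by auto
  define S where "S = {e \<in> E. \<not> e \<subseteq> X \<and> \<not> e \<subseteq> Y}"
  have S: "S \<subseteq> E" by (auto simp: S_def)
  have "{} \<notin> E" using edge by fastforce
  then have "{e \<in> E. e \<subseteq> X} \<inter> {e \<in> E. e \<subseteq> Y} = {}"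
    using dis by (auto simp: subset_iff disjoint_iff)
  then have "card ({e \<in> E. e \<subseteq> X} \<union> {e \<in> E. e \<subseteq> Y}) = ind X + ind Y"
    by (simp add: card_Un_disjoint ind_def)
  moreover have "S = E - ({e \<in> E. e \<subseteq> X} \<union> {e \<in> E. e \<subseteq> Y})" by (auto simp: S_def)
  ultimately have "card S = card E - (ind X + ind Y)" by (simp add: card_Diff_subset)
  moreover have "card V = card X + card Y" using card_Un_disjoint[of X Y] fin dis V by simp
  ultimately have cS: "card S = 3" using X Y card_E unfolding critical_def by linarith
  have "three_edge_separation G (X, {e \<in> E. e \<subseteq> X}) (Y, {e \<in> E. e \<subseteq> Y}) S"
    using fin dis V cS by (auto simp: three_edge_separation_def induced_subgraph_def graph_union_def
        delete_edges_def S_def)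
  then have "\<not> pairwise disjnt S"
    using no_3_sep unfolding nontrivial_three_edge_separation_def by blast
  then obtain e f where ef: "e \<in> S" "f \<in> S" "e \<noteq> f" "e \<inter> f \<noteq> {}"
    by (auto simp: pairwise_def disjnt_def)
  then obtain a where a: "a \<in> e" "a \<in> f" by auto
  have "card (S - {e, f}) = 1" using ef cS by (simp add: card_Diff_subset)
  then obtain g where g: "S - {e, f} = {g}" by (auto simp: card_1_singleton_iff)
  then have S_sub: "S \<subseteq> {e, f, g}" and "g \<in> S" by blast+
  then have gS: "g \<in> E" "\<not> g \<subseteq> X" "\<not> g \<subseteq> Y" by (simp_all add: S_def)
  have "a \<in> V" using a ef S edge by blast
  then consider "a \<in> X" | "a \<in> Y" using V by auto
  then show False
  proof cases
    case 1
    show False by (rule no[OF X c4(1) Y c4(2) dis V _ gS 1 a]) (use S_sub in \<open>simp add: S_def\<close>)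
  next
    case 2
    have "Y \<inter> X = {}" "Y \<union> X = V" "{e \<in> E. \<not> e \<subseteq> Y \<and> \<not> e \<subseteq> X} \<subseteq> {e, f, g}"
      using dis V S_sub by (auto simp: S_def)
    then show False by (rule no[OF Y c4(2) X c4(1) _ _ _ gS(1) gS(3) gS(2) 2 a])
  qed
qed

lemma card_V_ge_6: "card V \<ge> 6"
  using K5_minus_edge_if_card_5 not_K5_minus_edge card_V_ge_5 by (cases "card V = 5") auto

text \<open>Two common vertices would give \<open>H1\<close>; three would put at least 9 edges on 5
  vertices, which is a proper subset of \<open>V\<close>.\<close>

lemma K4_sets_cap:
  assumes K: "K4_set K" "K4_set K'" and "K \<noteq> K'"
  shows "card (K \<inter> K') \<le> 1"
proof (rule ccontr)
  assume big: "\<not> ?thesis"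
  have fin: "finite K" "finite K'" using K4_setD(3) K by auto
  have c: "card K = 4" "card K' = 4" using K by (auto simp: K4_set_def)
  have "card (K \<inter> K') < 4"
  proof (rule ccontr)
    assume "\<not> card (K \<inter> K') < 4"
    then have "card K \<le> card (K \<inter> K')" "card K' \<le> card (K \<inter> K')" using c by auto
    then have "K \<inter> K' = K" "K \<inter> K' = K'" using fin by (simp_all add: card_seteq)
    then show False using \<open>K \<noteq> K'\<close> by metis
  qed
  moreover have "card (K \<inter> K') \<noteq> 2" using H1_if_K4s K not_H1 by auto
  ultimately have cap: "card (K \<inter> K') = 3" using big by linarith
  then have cU: "card (K \<union> K') = 5" using card_Un_Int[OF fin] c by simp
  have "ind (K \<inter> K') = 3" using ind_K4_subset[OF K(1), of "K \<inter> K'"] cap by (simp add: choose_two)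
  then have "ind (K \<union> K') \<ge> 9" using ind_Un[of K K'] K by (simp add: K4_set_def)
  moreover have "K \<union> K' \<noteq> V" using cU card_V_ge_6 by auto
  then have "ind (K \<union> K') + 2 \<le> 2 * card (K \<union> K')"
    using K4_setD(1)[OF K(1)] K4_setD(1)[OF K(2)] c by (intro sparse) auto
  ultimately show False using cU by simp
qed

section \<open>Free nodes and their neighbourhoods\<close>

text \<open>The degree condition is written with \<open>touch\<close> because it says that
  \<open>{v}\<close> is tight.\<close>

definition free_node :: "'a \<Rightarrow> bool" where
  "free_node v \<longleftrightarrow> v \<in> V \<and> touch {v} = 3 \<and> (\<forall>K. K4_set K \<longrightarrow> v \<notin> K)"

lemma free_nodeD:
  assumes "free_node v"
  shows "v \<in> V" "touch {v} = 3" "node G v" "\<And>K. K4_set K \<Longrightarrow> v \<notin> K"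
  using assms by (auto simp: free_node_def node_def vert_degree_touch)

text \<open>A triangle on the neighbours would put \<open>v\<close> in a \<open>K\<^sub>4\<close>.
  The facts \<open>third\<close> and \<open>mixed\<close> exclude exactly two and exactly one
  adjacent pair.\<close>

lemma free_node_neighbours:
  assumes v: "free_node v" "\<not> admissible_node G v"
    and N: "neighbours G v = {x, y, z}" "distinct [x, y, z]"
  shows "{x, y} \<notin> E"
proof -
  note nd = free_nodeD(3)[OF v(1)] v(2)
  have vV: "v \<in> V" using free_nodeD v by blast
  have third: False
    if N: "neighbours G v = {x, y, z}" "distinct [x, y, z]"
      and e: "{x, y} \<notin> E" "{x, z} \<in> E" "{y, z} \<in> E" for x y z
  proof -
    obtain C where C: "tight C" "v \<notin> C" "C \<inter> neighbours G v = {z}"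
      using inadmissible_tight[OF nd N e(1)] by blast
    have mem: "x \<in> neighbours G v" "y \<in> neighbours G v" "z \<in> neighbours G v" using N(1) by simp_all
    have ne: "x \<noteq> y" "x \<noteq> z" "y \<noteq> z" using N(2) by simp_all
    have nv: "v \<notin> {x, y, z}" using neighbours_sub[of v] unfolding N(1) by blast
    have zC: "z \<in> C" "x \<notin> C" "y \<notin> C" using C(3) mem ne by blast+
    have sub: "{x, y, v} \<subseteq> neighbours G z - C"
      using e mem(3) zC C(2) by (simp add: neighbours_def insert_commute)
    have c3: "card {x, y, v} = 3" using ne nv by auto
    then have ge: "card (neighbours G z - C) \<ge> 3"
      using card_mono[OF _ sub] by simp
    have fC: "finite C" and CV: "C \<subset> V" and tC: "touch C = 2 * card C + 1"
      using C(1) by (auto simp: tight_def)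
    \<comment> \<open>Since \<open>z\<close> has the three neighbours \<open>x\<close>,
      \<open>y\<close>, \<open>v\<close> outside \<open>C\<close>, removing it from a larger
      \<open>C\<close> would push \<open>touch\<close> below its lower bound. So \<open>z\<close> is
      a node, and \<open>{x, y}\<close> separates \<open>{v, z}\<close> from the rest.\<close>
    have Cz: "C = {z}"
    proof (rule ccontr)
      assume "C \<noteq> {z}"
      then have "touch (C - {z}) \<ge> 2 * card (C - {z}) + 1"
        using CV zC by (intro touch_ge) auto
      then show False
        using touch_remove[OF zC(1)] card.remove[OF fC zC(1)] tC ge by linarith
    qed
    have "card (neighbours G z) = 3" using tC unfolding card_neighbours Cz by simp
    then have "{x, y, v} = neighbours G z"
      using sub c3 by (intro card_subset_eq) auto
    then have nz: "neighbours G z = {x, y, v}" by simp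
    have inV: "x \<in> V" "y \<in> V" "z \<in> V" using mem neighbours_sub by blast+
    have "K4_set {v, z, x, y} \<or> K4_set (V - {v, z})"
    proof (rule two_sep)
      show "{v, z, x, y} \<union> (V - {v, z}) = V" using inV vV by blast
      have "{v, z, x, y} \<inter> (V - {v, z}) = {x, y}" using inV ne nv by blast
      then show "card ({v, z, x, y} \<inter> (V - {v, z})) = 2" using ne by simp
      show "{v, z, x, y} - (V - {v, z}) \<noteq> {}" by blast
      have "card {v, z, x, y} < card V"
        using card_V_ge_6 card_insert_le_m1[of 4 "{z, x, y}" v] ne by simp
      then have "\<not> V \<subseteq> {v, z, x, y}" using card_mono[of "{v, z, x, y}" V] by auto
      then show "V - {v, z} - {v, z, x, y} \<noteq> {}" by blast
    next
      fix a b assume a: "a \<in> {v, z, x, y} - (V - {v, z})" and b: "b \<in> V - {v, z} - {v, z, x, y}"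
      have "a = v \<or> a = z" using a inV by blast
      moreover have "b \<notin> neighbours G v" "b \<notin> neighbours G z" unfolding N(1) nz using b by blast+
      ultimately show "{a, b} \<notin> E" by (auto simp: neighbours_def insert_commute)
    qed
    \<comment> \<open>Both sides contain the non-adjacent pair \<open>x\<close>, \<open>y\<close>,
      so neither is complete.\<close>
    then show False
      using K4_setD(5)[of "{v, z, x, y}" x y] K4_setD(5)[of "V - {v, z}" x y] e(1) inV ne nv by blast
  qed
  have mixed: "{x, z} \<notin> E"
    if N: "neighbours G v = {x, y, z}" "distinct [x, y, z]" and e: "{x, y} \<notin> E" "{y, z} \<notin> E" for x y z
  proof -
    obtain C where C: "tight C" "v \<notin> C" "C \<inter> neighbours G v = {z}"
      using inadmissible_tight[OF nd N e(1)] by blast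
    have N': "neighbours G v = {y, z, x}" "distinct [y, z, x]" using N by auto
    obtain A where A: "tight A" "v \<notin> A" "A \<inter> neighbours G v = {x}"
      using inadmissible_tight[OF nd N' e(2)] by blast
    show ?thesis by (rule tight_at_neighbours_disjoint(2)[OF A C N vV])
  qed
  have N2: "neighbours G v = {y, z, x}" "distinct [y, z, x]"
    and N3: "neighbours G v = {z, x, y}" "distinct [z, x, y]"
    using N by auto
  have not_all: "\<not> ({x, y} \<in> E \<and> {y, z} \<in> E \<and> {x, z} \<in> E)"
  proof
    assume all: "{x, y} \<in> E \<and> {y, z} \<in> E \<and> {x, z} \<in> E"
    have nv: "v \<notin> {x, y, z}" using neighbours_sub[of v] unfolding N(1) by blast
    have "{x, y, z} \<subseteq> V" using neighbours_sub[of v] unfolding N(1) by blast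
    moreover have "{x, v} \<in> E" "{y, v} \<in> E" "{z, v} \<in> E"
      using N(1) by (auto simp: neighbours_def)
    ultimately have "K4_set {v, x, y, z}"
      using N(2) all nv vV by (intro K4_setI) (auto simp: insert_commute)
    then show False using free_nodeD(4)[OF v(1)] by blast
  qed
  show ?thesis
    using not_all third[OF N] third[OF N2] third[OF N3] mixed[OF N] mixed[OF N2] mixed[OF N3]
    by (simp only: insert_commute) (metis insert_commute)
qed

text \<open>All pairs of neighbours are non-adjacent, so all three 1-reductions are available and
  blocked; each yields the tight set around the third neighbour.\<close>

lemma inadmissible_free_node:
  assumes v: "free_node v" "\<not> admissible_node G v"
  obtains S where "\<And>x. x \<in> neighbours G v \<Longrightarrow> tight (S x) \<and> v \<notin> S x \<and> S x \<inter> neighbours G v = {x}"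
    and "\<And>x y. x \<in> neighbours G v \<Longrightarrow> y \<in> neighbours G v \<Longrightarrow> x \<noteq> y \<Longrightarrow> S x \<inter> S y = {}"
proof -
  have c3: "card (neighbours G v) = 3" using free_nodeD(2)[OF v(1)] by (simp add: card_neighbours)
  have others: "\<exists>y z. neighbours G v = {x, y, z} \<and> distinct [x, y, z]" if "x \<in> neighbours G v" for x
  proof -
    have "card (neighbours G v - {x}) = 2" using c3 that by simp
    then obtain y z where yz: "neighbours G v - {x} = {y, z}" "y \<noteq> z" unfolding card_2_iff by blast
    have "y \<in> neighbours G v - {x}" "z \<in> neighbours G v - {x}" unfolding yz(1) by simp_all
    then have "distinct [x, y, z]" using yz(2) by auto
    moreover have "neighbours G v = insert x (neighbours G v - {x})" using that by blast
    ultimately show ?thesis unfolding yz(1) by blast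
  qed
  have "\<exists>C. tight C \<and> v \<notin> C \<and> C \<inter> neighbours G v = {x}" if x: "x \<in> neighbours G v" for x
  proof -
    obtain y z where N: "neighbours G v = {x, y, z}" "distinct [x, y, z]" using others[OF x] by blast
    then have N': "neighbours G v = {y, z, x}" "distinct [y, z, x]" by auto
    show ?thesis
      using inadmissible_tight[OF free_nodeD(3)[OF v(1)] v(2) N' free_node_neighbours[OF v N']] .
  qed
  then obtain S where S: "\<And>x. x \<in> neighbours G v \<Longrightarrow> tight (S x) \<and> v \<notin> S x \<and> S x \<inter> neighbours G v = {x}"
    by metis
  have "S x \<inter> S y = {}" if xy: "x \<in> neighbours G v" "y \<in> neighbours G v" "x \<noteq> y" for x y
  proof -
    obtain z w where N: "neighbours G v = {x, z, w}" "distinct [x, z, w]" using others[OF xy(1)] by blast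
    have "y = z \<or> y = w" using xy(2,3) N(1) by simp
    then have "\<exists>u. neighbours G v = {x, u, y} \<and> distinct [x, u, y]"
    proof
      assume "y = z"
      then have "neighbours G v = {x, w, y}" "distinct [x, w, y]" using N by auto
      then show ?thesis by blast
    next
      assume "y = w"
      then show ?thesis using N by blast
    qed
    then obtain u where u: "neighbours G v = {x, u, y}" "distinct [x, u, y]" by blast
    have "tight (S x)" "v \<notin> S x" "S x \<inter> neighbours G v = {x}"
      "tight (S y)" "v \<notin> S y" "S y \<inter> neighbours G v = {y}"
      using S[OF xy(1)] S[OF xy(2)] by simp_all
    then show ?thesis by (rule tight_at_neighbours_disjoint(1)[OF _ _ _ _ _ _ u free_nodeD(1)[OF v(1)]])
  qed
  with S show ?thesis using that by blast
qed

section \<open>Tight sets inside or across a \<open>K\<^sub>4\<close>\<close>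

text \<open>Of the 6 edges of \<open>K\<close>, all but those inside \<open>K - R\<close> meet
  \<open>R\<close>. For \<open>card R\<close> equal to 1, 2, 3, 4 the equation yields 0, 0, 1, 3
  leaving edges.\<close>

lemma card_leaving_K4:
  assumes R: "tight R" "R \<subseteq> K" and K: "K4_set K"
  shows "card {e \<in> E. e \<inter> R \<noteq> {} \<and> \<not> e \<subseteq> K} + 6 = 2 * card R + 1 + ((4 - card R) choose 2)"
proof -
  note fK = K4_setD(3)[OF K]
  let ?O = "{e \<in> E. e \<inter> R \<noteq> {} \<and> \<not> e \<subseteq> K}" and ?I = "{e \<in> E. e \<inter> R \<noteq> {} \<and> e \<subseteq> K}"
  have "touch R = card (?O \<union> ?I)"
    unfolding touch_def by (rule arg_cong[of _ _ card]) blast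
  also have "\<dots> = card ?O + card ?I" by (rule card_Un_disjoint) auto
  finally have "touch R = card ?O + card ?I" .
  moreover have "ind K = card (?I \<union> {e \<in> E. e \<subseteq> K - R})"
    unfolding ind_def by (rule arg_cong[of _ _ card]) blast
  then have "ind K = card ?I + ind (K - R)"
    unfolding ind_def[of "K - R"] by (subst (asm) card_Un_disjoint) auto
  moreover have "ind (K - R) = (card K - card R) choose 2"
    using ind_K4_subset[OF K, of "K - R"] card_Diff_subset[of R K] R(2) fK finite_subset[of R K] by simp
  moreover have "touch R = 2 * card R + 1" "card K = 4" "ind K = 6"
    using R(1) K by (auto simp: tight_def K4_set_def)
  ultimately show ?thesis by simp
qed

lemma card_leaving_K4_proper:
  assumes R: "tight R" "R \<subset> K" and K: "K4_set K" and e: "e \<in> E" "e \<inter> R \<noteq> {}" "\<not> e \<subseteq> K"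
  shows "card R = 3" "{e \<in> E. e \<inter> R \<noteq> {} \<and> \<not> e \<subseteq> K} = {e}"
proof -
  let ?O = "{e \<in> E. e \<inter> R \<noteq> {} \<and> \<not> e \<subseteq> K}"
  have "card R < 4" using psubset_card_mono[OF K4_setD(3)[OF K] R(2)] K4_setD(2)[OF K] by simp
  moreover have "card R \<noteq> 0" using R finite_subset[of R K] K4_setD(3)[OF K] by (auto simp: tight_def)
  ultimately have "card R = 1 \<or> card R = 2 \<or> card R = 3" by linarith
  moreover have "card ?O + 6 = 2 * card R + 1 + ((4 - card R) choose 2)"
    using R(2) by (intro card_leaving_K4[OF R(1) _ K]) blast
  moreover have eO: "e \<in> ?O" using e by blast
  have "finite ?O" by simp
  then have "card ?O \<noteq> 0" using card_0_eq eO by blast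
  moreover have "r = 3 \<and> m = 1"
    if "r = 1 \<or> r = 2 \<or> r = 3" "m \<noteq> 0" "m + 6 = 2 * r + 1 + ((4 - r) choose 2)" for r m :: nat
    using that by (elim disjE) (simp_all add: choose_two)
  ultimately have *: "card R = 3 \<and> card ?O = 1" by blast
  then show "card R = 3" by blast
  then obtain f where f: "?O = {f}" using * card_1_singletonE by blast
  have "e \<in> {f}" using eO unfolding f .
  then show "?O = {e}" unfolding f by simp
qed

text \<open>Otherwise \<open>K\<close> and its complement would be two critical sets partitioning
  \<open>V\<close>, neither of them a singleton.\<close>

lemma K4_not_tight:
  assumes "K4_set K" "card (V - K) \<ge> 2"
  shows "\<not> tight K"
proof
  assume "tight K"
  then have "critical (V - K)" using tight_iff_critical K4_setD(1)[OF assms(1)] by blast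
  then show False
    using critical_disjoint[of K "V - K"] K4_setD[OF assms(1)] assms(2) by auto
qed

text \<open>If \<open>R\<close> were inside \<open>K\<close>, it would have three vertices and
  \<open>{b, u}\<close> would be its only edge leaving \<open>K\<close>. Then \<open>u\<close> and
  the fourth vertex of \<open>K\<close> separate \<open>R\<close> from the rest, and both sides
  contain the free node \<open>u\<close>, so neither is a \<open>K\<^sub>4\<close>.\<close>

lemma attached_not_in_K4:
  assumes R: "tight R" "card (V - R) \<ge> 2" and u: "free_node u" "u \<notin> R" and b: "b \<in> R" "{b, u} \<in> E"
    and K: "K4_set K"
  shows "\<not> R \<subseteq> K"
proof
  assume RK: "R \<subseteq> K"
  have "R \<noteq> K" using K4_not_tight[OF K] R by blast
  then have RK': "R \<subset> K" using RK by blast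
  have uK: "u \<notin> K" and uV: "u \<in> V" using free_nodeD[OF u(1)] K by blast+
  have cR: "card R = 3" and out: "{e \<in> E. e \<inter> R \<noteq> {} \<and> \<not> e \<subseteq> K} = {{b, u}}"
    using card_leaving_K4_proper[OF R(1) RK' K b(2)] b(1) uK by blast+
  note fK = K4_setD(3)[OF K] and cK = K4_setD(2)[OF K]
  have "finite R" using RK fK finite_subset by blast
  then have "card (K - R) = 1" using cR cK RK by (simp add: card_Diff_subset)
  then obtain s where s: "K - R = {s}" using card_1_singletonE by blast
  have "K4_set (insert u K) \<or> K4_set (V - R)"
  proof (rule two_sep)
    show "insert u K \<union> (V - R) = V" using uV K4_setD(1)[OF K] RK by blast
    have "insert u K \<inter> (V - R) = {u, s}" using uV u(2) K4_setD(1)[OF K] s by blast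
    moreover have "u \<noteq> s" using uK s by blast
    ultimately show "card (insert u K \<inter> (V - R)) = 2" by simp
    show "insert u K - (V - R) \<noteq> {}" using RK b(1) K4_setD(1)[OF K] by blast
    have "card (insert u K) < card V" using card_V_ge_6 cK fK uK by simp
    then have "\<not> V \<subseteq> insert u K" using card_mono[of "insert u K" V] fK by auto
    then show "V - R - insert u K \<noteq> {}" using RK by blast
  next
    fix a c assume a: "a \<in> insert u K - (V - R)" and c: "c \<in> V - R - insert u K"
    have aR: "a \<in> R" using a uV u(2) K4_setD(1)[OF K] by blast
    show "{a, c} \<notin> E"
    proof
      assume "{a, c} \<in> E"
      then have "{a, c} \<in> {e \<in> E. e \<inter> R \<noteq> {} \<and> \<not> e \<subseteq> K}" using aR c by blast
      then have "{a, c} = {b, u}" unfolding out by simp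
      then have "c \<in> {b, u}" by blast
      then show False using c b(1) by blast
    qed
  qed
  then show False using free_nodeD(4)[OF u(1)] uV u(2) by blast
qed

text \<open>The vertex set \<open>K \<inter> A\<close> is joined to the rest of the graph only through the single vertex of
  \<open>K - A\<close> and through \<open>A - K\<close>, so if \<open>A - K\<close> were a single vertex or contained in another \<open>K\<^sub>4\<close>,
  there would be a nontrivial 2-vertex-separation.\<close>

lemma tight_diff_K4:
  assumes A: "tight A" "card (V - A) \<ge> 2" "\<And>K. K4_set K \<Longrightarrow> \<not> A \<subseteq> K"
    and K: "K4_set K" "K \<inter> A \<noteq> {}" "\<not> K \<subseteq> A"
  shows "tight (A - K)" "card (A - K) \<ge> 2" "\<And>K'. K4_set K' \<Longrightarrow> \<not> A - K \<subseteq> K'"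
proof -
  define D where "D = V - A"
  have AV: "A \<subseteq> V" using A(1) by (auto simp: tight_def)
  have critD: "critical D" using A(1) AV by (simp add: D_def tight_iff_critical)
  have cD: "card D \<ge> 4" using critical_card critD A(2) by (simp add: D_def)
  have fin: "finite A" "finite D" using AV by (auto simp: D_def)
  note KV = K4_setD(1)[OF K(1)] and cK = K4_setD(2)[OF K(1)] and fK = K4_setD(3)[OF K(1)]
  \<comment> \<open>The plan is to uncross \<open>A\<close> with the tight set \<open>V - K\<close>:
    the intersection is \<open>A - K\<close>, and the complement of the union is
    \<open>K - A\<close>, a critical set with fewer than four vertices and hence a single vertex
    \<open>s\<close>.\<close>
  have tK: "tight (V - K)" using K4_setD(4)[OF K(1)] KV by (simp add: critical_iff_tight)
  have i: "A \<inter> (V - K) = A - K" using AV by blast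
  have ne: "A \<inter> (V - K) \<noteq> {}" "A \<union> (V - K) \<noteq> V" using A(3)[OF K(1)] K(3) AV KV by blast+
  show tight_S: "tight (A - K)" using tight_uncross(1)[OF A(1) tK ne] i by simp
  have no: "{a, b} \<notin> E" if "a \<in> K \<inter> A" "b \<in> D - K" for a b
    using tight_uncross(3)[OF A(1) tK ne, of a b] that AV KV by (simp add: D_def)
  have "V - (A \<union> (V - K)) = K - A" using KV by blast
  then have "critical (K - A)"
    using tight_uncross(2)[OF A(1) tK ne] tight_iff_critical[of "A \<union> (V - K)"] AV by simp
  moreover have lt: "card (K - A) < 4"
    using psubset_card_mono[OF fK, of "K - A"] K(2) cK by auto
  moreover have "card (K - A) \<noteq> 0" using K(3) fK by auto
  ultimately have "card (K - A) = 1" using critical_card[of "K - A"] by linarith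
  then obtain s where s: "K - A = {s}" using card_1_singletonE by blast
  have sK: "s \<in> K" "s \<in> D" "s \<notin> A" using s KV by (auto simp: D_def)
  have KA: "w \<in> A \<or> w = s" if "w \<in> K" for w using s that by blast
  \<comment> \<open>Otherwise \<open>x\<close> and \<open>s\<close> would separate
    \<open>K \<inter> A\<close> from the rest, with at least five vertices on each side.\<close>
  have other: "\<exists>r\<in>K \<inter> A. \<exists>x'\<in>A - K. x' \<noteq> x \<and> {r, x'} \<in> E" if x: "x \<in> A - K" for x
  proof (rule ccontr)
    assume none: "\<not> ?thesis"
    let ?W = "V - (K \<inter> A)"
    have "K4_set (insert x K) \<or> K4_set ?W"
    proof (rule two_sep)
      show "insert x K \<union> ?W = V" using KV x AV by blast
      have "insert x K \<inter> ?W = {x, s}" using x AV KA sK KV by blast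
      moreover have "x \<noteq> s" using x sK by blast
      ultimately show "card (insert x K \<inter> ?W) = 2" by simp
      show "insert x K - ?W \<noteq> {}" using K(2) by blast
      have "card (insert x K) < card V" using card_V_ge_6 cK fK x by simp
      then have "\<not> V \<subseteq> insert x K" using card_mono[of "insert x K" V] fK by auto
      then show "?W - insert x K \<noteq> {}" by blast
    next
      fix a b assume a: "a \<in> insert x K - ?W" and b: "b \<in> ?W - insert x K"
      have aKA: "a \<in> K \<inter> A" using a x AV KV by blast
      show "{a, b} \<notin> E"
      proof (cases "b \<in> A")
        case True
        then show ?thesis using none aKA b by blast
      next
        case False
        then show ?thesis using no[OF aKA, of b] b by (simp add: D_def)
      qed
    qed
    moreover have "card (insert x K) = 5" using x cK fK by simp
    moreover have "insert x D \<subseteq> ?W" using x AV by (auto simp: D_def)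
    then have "card (insert x D) \<le> card ?W" by (intro card_mono) auto
    then have "card ?W \<ge> 5" using x cD fin by (simp add: D_def)
    ultimately show False by (auto simp: K4_set_def)
  qed
  obtain x0 where x0: "x0 \<in> A - K" using ne(1) i by blast
  obtain r1 x1 where 1: "r1 \<in> K \<inter> A" "x1 \<in> A - K" "{r1, x1} \<in> E" using other[OF x0] by blast
  obtain r2 x2 where 2: "r2 \<in> K \<inter> A" "x2 \<in> A - K" "x2 \<noteq> x1" "{r2, x2} \<in> E"
    using other[OF 1(2)] by blast
  show "card (A - K) \<ge> 2" using card_mono[of "A - K" "{x1, x2}"] 1 2 fin by simp
  fix K' assume K': "K4_set K'"
  show "\<not> A - K \<subseteq> K'"
  proof
    assume SK: "A - K \<subseteq> K'"
    have "A - K \<noteq> K'"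
    proof
      assume "A - K = K'"
      moreover have "card (V - K') \<ge> card (V - A)" using \<open>A - K = K'\<close> by (intro card_mono) auto
      ultimately show False using K4_not_tight[OF K'] tight_S A(2) by auto
    qed
    then have SK': "A - K \<subset> K'" using SK by blast
    \<comment> \<open>Only one edge at \<open>A - K\<close> can leave \<open>K'\<close>, whereas the
      two edges found above would both leave it if \<open>K'\<close> missed
      \<open>K \<inter> A\<close>.\<close>
    have "\<exists>r\<in>K \<inter> A. r \<in> K'"
    proof (rule ccontr)
      assume none: "\<not> ?thesis"
      have "{e \<in> E. e \<inter> (A - K) \<noteq> {} \<and> \<not> e \<subseteq> K'} = {{r1, x1}}"
        using card_leaving_K4_proper(2)[OF tight_S SK' K' 1(3)] 1 none by blast
      moreover have "{r2, x2} \<in> {e \<in> E. e \<inter> (A - K) \<noteq> {} \<and> \<not> e \<subseteq> K'}" using 2 none by blast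
      ultimately have "{r2, x2} = {r1, x1}" by simp
      then have "x2 \<in> {r1, x1}" by blast
      then show False using 1 2 by blast
    qed
    then obtain r where r: "r \<in> K \<inter> A" "r \<in> K'" by blast
    have "K \<noteq> K'" using SK 1(2) by blast
    then have "card (K \<inter> K') \<le> 1" using K4_sets_cap[OF K(1) K'] by blast
    then have rK: "w = r" if "w \<in> K" "w \<in> K'" for w
      using that r fK card_le_Suc0_iff_eq[of "K \<inter> K'"] by auto
    have K'A: "w \<in> A - K" if w: "w \<in> K'" "w \<noteq> r" for w
    proof -
      have "w \<notin> K" using rK w by blast
      moreover have "{r, w} \<in> E" using K4_setD(5)[OF K' r(2) w(1)] w(2) by blast
      ultimately show ?thesis using no[OF r(1), of w] K4_setD(1)[OF K'] w(1) unfolding D_def by blast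
    qed
    have Sr: "A - K = K' - {r}" using SK r K'A by blast
    have cS: "card (A - K) = 3" unfolding Sr using r(2) K4_setD(2,3)[OF K'] by simp
    have "card {e \<in> E. e \<inter> (A - K) \<noteq> {} \<and> \<not> e \<subseteq> K'} = 1"
      using card_leaving_K4[OF tight_S SK K'] cS by (simp add: choose_two)
    then obtain f where f: "{e \<in> E. e \<inter> (A - K) \<noteq> {} \<and> \<not> e \<subseteq> K'} = {f}"
      using card_1_singletonE by blast
    have "f \<in> {e \<in> E. e \<inter> (A - K) \<noteq> {} \<and> \<not> e \<subseteq> K'}" unfolding f by simp
    then have "f \<inter> (A - K) \<noteq> {}" by simp
    then obtain x where x: "x \<in> f" "x \<in> A - K" by blast
    \<comment> \<open>Now \<open>A - K\<close> is \<open>K'\<close> without \<open>r\<close>, and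
      \<open>f\<close>, with end \<open>x\<close>, is its only edge leaving \<open>K'\<close>. As
      \<open>K \<inter> A\<close> reaches \<open>D\<close> only in \<open>s\<close>, the vertices
      \<open>s\<close> and \<open>x\<close> separate \<open>A\<close> from \<open>D\<close>.\<close>
    have "K4_set (insert s A) \<or> K4_set (insert x D)"
    proof (rule two_sep)
      show "insert s A \<union> insert x D = V" using AV x sK by (auto simp: D_def)
      have "insert s A \<inter> insert x D = {s, x}" using x sK by (auto simp: D_def)
      moreover have "s \<noteq> x" using x sK by blast
      ultimately show "card (insert s A \<inter> insert x D) = 2" by simp
      have "r \<in> insert s A - insert x D" using r x by (auto simp: D_def)
      then show "insert s A - insert x D \<noteq> {}" by blast
      have "card (D - {s}) \<ge> 3" using cD sK(2) fin by simp
      then have "D - {s} \<noteq> {}" by (metis card.empty not_numeral_le_zero)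
      then show "insert x D - insert s A \<noteq> {}" by (auto simp: D_def)
    next
      fix a b assume a: "a \<in> insert s A - insert x D" and b: "b \<in> insert x D - insert s A"
      have a': "a \<in> A" "a \<noteq> x" and b': "b \<in> D" "b \<noteq> s" "b \<notin> A"
        using a b sK x by (auto simp: D_def)
      have bK: "b \<notin> K" using KA b' by blast
      have bK': "b \<notin> K'" using K'A[of b] b' r(1) by blast
      show "{a, b} \<notin> E"
      proof (cases "a \<in> K")
        case True
        then show ?thesis using no a'(1) b'(1) bK by blast
      next
        case False
        show ?thesis
        proof
          assume "{a, b} \<in> E"
          then have "{a, b} \<in> {e \<in> E. e \<inter> (A - K) \<noteq> {} \<and> \<not> e \<subseteq> K'}"
            using False a'(1) bK' by blast
          then have "{a, b} = f" unfolding f by simp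
          then have "x \<in> {a, b}" using x(1) by simp
          then show False using a'(2) b'(3) x(2) by blast
        qed
      qed
    qed
    moreover have "insert x1 K \<subseteq> insert s A" using KA 1(2) by blast
    then have "card (insert x1 K) \<le> card (insert s A)" using fin by (intro card_mono) auto
    then have "card (insert s A) \<ge> 5" using 1(2) cK fK by simp
    moreover have "card (insert x D) \<ge> 5" using x(2) cD fin by (simp add: D_def)
    ultimately show False by (auto simp: K4_set_def)
  qed
qed

section \<open>Free nodes inside tight sets\<close>

lemma two_free_nodes_if_no_crossing:
  assumes A: "tight A" "card (V - A) \<ge> 2" "card A \<ge> 2"
    and no_cross: "\<And>K. K4_set K \<Longrightarrow> K \<inter> A \<noteq> {} \<Longrightarrow> K \<subseteq> A"
  shows "card {v \<in> A. free_node v} \<ge> 2"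
proof -
  have AV: "A \<subset> V" and tA: "touch A = 2 * card A + 1" and neA: "A \<noteq> {}"
    using A(1) by (auto simp: tight_def)
  have fA: "finite A" using AV by auto
  \<comment> \<open>The maximal critical subsets partition \<open>A\<close>. Since \<open>touch\<close> and \<open>ind\<close> add up to a degree sum,
    at least two parts are tight as well, and a critical tight part is a single node by \<open>critical_disjoint\<close>.\<close>
  define P where "P = {M. M \<subseteq> A \<and> critical M \<and> (\<forall>M'. M' \<subseteq> A \<longrightarrow> critical M' \<longrightarrow> M \<subseteq> M' \<longrightarrow> M' = M)}"
  have P: "M \<subseteq> A" "critical M" "finite M" if "M \<in> P" for M
    using that fA finite_subset by (auto simp: P_def)
  have P_max: "M' = M" if "M \<in> P" "M' \<subseteq> A" "critical M'" "M \<subseteq> M'" for M M'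
    using that unfolding P_def by blast
  have fP: "finite P" using fA by (auto simp: P_def)
  have disj: "M \<inter> M' = {}" if M: "M \<in> P" "M' \<in> P" "M \<noteq> M'" for M M'
  proof (rule ccontr)
    assume "M \<inter> M' \<noteq> {}"
    then have "critical (M \<union> M')" using P M AV by (intro critical_Un) blast+
    then have "M \<union> M' = M" "M \<union> M' = M'" using P_max M P by (metis Un_least Un_upper1 Un_upper2)+
    then show False using M(3) by blast
  qed
  have "\<exists>M\<in>P. a \<in> M" if "a \<in> A" for a
  proof -
    let ?C = "{M. M \<subseteq> A \<and> critical M \<and> a \<in> M}"
    have "finite ?C" using fA by auto
    moreover have "{a} \<in> ?C" using that AV critical_singleton by blast
    ultimately obtain M where M: "M \<in> ?C" "\<forall>M'\<in>?C. M \<subseteq> M' \<longrightarrow> M = M'"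
      using finite_has_maximal2[of ?C "{a}"] by meson
    then have "M \<in> P" unfolding P_def by blast
    then show ?thesis using M by blast
  qed
  then have UP: "\<Union>P = A" using P by blast
  have Usum: "(\<Sum>M\<in>P. \<Sum>x\<in>M. f x) = (\<Sum>x\<in>A. f x)" for f :: "'a \<Rightarrow> nat"
    using sum.Union_disjoint[of P f] P(3) disj unfolding UP by simp
  have cA: "(\<Sum>M\<in>P. card M) = card A" using Usum[of "\<lambda>_. 1"] by simp
  have "(\<Sum>M\<in>P. touch M + ind M) = (\<Sum>M\<in>P. \<Sum>x\<in>M. touch {x})"
  proof (rule sum.cong)
    fix M assume "M \<in> P"
    then have "M \<subseteq> V" using P(1) AV by blast
    then show "touch M + ind M = (\<Sum>x\<in>M. touch {x})" by (simp add: handshake)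
  qed simp
  also have "\<dots> = touch A + ind A" using Usum AV handshake[of A] by auto
  finally have total: "(\<Sum>M\<in>P. touch M + ind M) = touch A + ind A" .
  define T where "T = {M \<in> P. tight M}"
  \<comment> \<open>A critical part has \<open>ind M = 2 * card M - 2\<close> and
    \<open>touch M\<close> at least \<open>2 * card M + 1\<close>, so it falls short of
    \<open>4 * card M\<close> by at most 1, and only if it is tight.\<close>
  have "4 * card M \<le> touch M + ind M + (if tight M then 1 else 0)" if "M \<in> P" for M
  proof -
    have "M \<noteq> {}" "M \<subset> V" "ind M + 2 = 2 * card M" using P(2)[OF that] by (auto simp: critical_def)
    then show ?thesis using touch_ge[of M] by (auto simp: tight_def)
  qed
  then have "(\<Sum>M\<in>P. 4 * card M) \<le> (\<Sum>M\<in>P. touch M + ind M + (if tight M then 1 else 0))"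
    by (rule sum_mono)
  also have "\<dots> = touch A + ind A + card T"
    using total fP by (simp add: sum.distrib sum.If_cases T_def Int_def)
  finally have "4 * card A \<le> touch A + ind A + card T"
    using cA by (simp add: sum_distrib_left[symmetric])
  \<comment> \<open>With one more edge, \<open>A\<close> and its complement would both be critical.
    The total for \<open>A\<close> is therefore at most \<open>4 * card A - 2\<close>, which
    requires two tight parts.\<close>
  moreover have "ind A + 3 \<le> 2 * card A"
  proof -
    have "ind A + 2 \<noteq> 2 * card A"
    proof
      assume "ind A + 2 = 2 * card A"
      then have "critical A" using AV neA by (simp add: critical_def)
      moreover have "critical (V - A)" using A(1) AV tight_iff_critical by blast
      ultimately show False using critical_disjoint[of A "V - A"] A(2,3) AV by auto
    qed
    then show ?thesis using sparse[OF neA AV] by linarith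
  qed
  ultimately have "card T \<ge> 2" using tA by linarith
  moreover have "T \<subseteq> (\<lambda>v. {v}) ` {v \<in> A. free_node v}"
  proof
    fix M assume "M \<in> T"
    then have M: "M \<in> P" "tight M" by (auto simp: T_def)
    have MA: "M \<subseteq> A" and MV: "M \<subseteq> V" using P M AV by blast+
    have "card (V - A) \<le> card (V - M)" using MA by (intro card_mono) auto
    then have "card M = 1"
      using critical_disjoint[of M "V - M"] P(2)[OF M(1)] M(2) MV A(2) tight_iff_critical[OF MV] by auto
    then obtain v where v: "M = {v}" using card_1_singletonE by blast
    \<comment> \<open>A \<open>K\<^sub>4\<close> through \<open>v\<close> would lie in
      \<open>A\<close> and be a larger critical set than the maximal one \<open>{v}\<close>.\<close>
    have "v \<notin> K" if K: "K4_set K" for K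
    proof
      assume "v \<in> K"
      then have "K \<subseteq> A" using no_cross[OF K] MA v by blast
      then have "K = M" using P_max[OF M(1) _ K4_setD(4)[OF K]] v \<open>v \<in> K\<close> by blast
      then show False using K4_setD(2)[OF K] \<open>card M = 1\<close> by simp
    qed
    moreover have "touch {v} = 3" using M(2) v by (simp add: tight_def)
    ultimately have "free_node v" using v MV by (simp add: free_node_def)
    then show "M \<in> (\<lambda>v. {v}) ` {v \<in> A. free_node v}" using v MA by blast
  qed
  then have "card T \<le> card {v \<in> A. free_node v}"
    using fA by (intro surj_card_le) auto
  ultimately show ?thesis by linarith
qed

text \<open>Induction on \<open>card A\<close>: removing a \<open>K\<^sub>4\<close> that crosses the
  boundary preserves all hypotheses, and without crossings the previous count applies.\<close>

lemma two_free_nodes: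
  assumes "tight A" "card (V - A) \<ge> 2" "card A \<ge> 2" "\<And>K. K4_set K \<Longrightarrow> \<not> A \<subseteq> K"
  shows "card {v \<in> A. free_node v} \<ge> 2"
  using assms
proof (induction "card A" arbitrary: A rule: less_induct)
  case less
  have AV: "A \<subseteq> V" using less.prems(1) by (auto simp: tight_def)
  have fA: "finite A" using AV by simp
  show ?case
  proof (cases "\<exists>K. K4_set K \<and> K \<inter> A \<noteq> {} \<and> \<not> K \<subseteq> A")
    case True
    then obtain K where K: "K4_set K" "K \<inter> A \<noteq> {}" "\<not> K \<subseteq> A" by blast
    note S = tight_diff_K4[OF less.prems(1,2,4) K]
    have "card (A - K) < card A" using K(2) fA by (intro psubset_card_mono) blast+
    moreover have "card (V - A) \<le> card (V - (A - K))" by (intro card_mono) auto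
    ultimately have "card {v \<in> A - K. free_node v} \<ge> 2"
      using less.prems(2) by (intro less.hyps S) linarith+
    also have "card {v \<in> A - K. free_node v} \<le> card {v \<in> A. free_node v}"
      using fA by (intro card_mono) auto
    finally show ?thesis .
  next
    case False
    then show ?thesis using less.prems by (intro two_free_nodes_if_no_crossing) blast+
  qed
qed

section \<open>Descent to an admissible node in a tight set\<close>

text \<open>By minimality, no smaller tight subset may contain a vertex that is not free and still
  avoid lying in a \<open>K\<^sub>4\<close>. An inadmissible leaf \<open>u\<close> of the free nodes
  in \<open>A\<close> always produces such a subset.\<close>

lemma admissible_in_tight:
  assumes "tight A" "card (V - A) \<ge> 2" "\<And>K. K4_set K \<Longrightarrow> \<not> A \<subseteq> K" "b \<in> A" "\<not> free_node b"
  shows "\<exists>v\<in>A. admissible_node G v"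
  using assms
proof (induction "card A" arbitrary: A b rule: less_induct)
  case less
  have AV: "A \<subset> V" and tA: "touch A = 2 * card A + 1" using less.prems(1) by (auto simp: tight_def)
  have fA: "finite A" using AV by auto
  have smaller: "\<exists>v\<in>A. admissible_node G v"
    if R: "tight R" "R \<subset> A" "\<And>K. K4_set K \<Longrightarrow> \<not> R \<subseteq> K" "c \<in> R" "\<not> free_node c" for R c
  proof -
    have "card R < card A" using R(2) fA psubset_card_mono by blast
    moreover have "card (V - A) \<le> card (V - R)" using R(2) by (intro card_mono) auto
    then have "card (V - R) \<ge> 2" using less.prems(2) by linarith
    ultimately have "\<exists>v\<in>R. admissible_node G v" using less.hyps[of R c] R by blast
    then show ?thesis using R(2) by blast
  qed
  show ?case
  proof (rule ccontr)
    assume none: "\<not> ?case"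
    define F where "F = {v \<in> A. free_node v}"
    have "F \<noteq> {}"
    proof (cases "card A \<ge> 2")
      case True
      then have "card F \<ge> 2" using two_free_nodes less.prems unfolding F_def by blast
      then show ?thesis by (metis card.empty not_numeral_le_zero)
    next
      case False
      moreover have "card A \<noteq> 0" using less.prems(4) fA by auto
      ultimately have "card A = 1" by linarith
      then have A: "A = {b}" using less.prems(4) card_1_singletonE by blast
      then have "touch {b} = 3" using tA by simp
      then obtain K where "K4_set K" "b \<in> K" using less.prems(4,5) AV unfolding free_node_def by blast
      then show ?thesis using less.prems(3) A by blast
    qed
    then obtain u where u: "u \<in> F" "card (neighbours G u \<inter> F) \<le> 1"
      using node_leaf[of F] AV free_nodeD(2) unfolding F_def by blast
    have fu: "free_node u" and uA: "u \<in> A" and nu: "\<not> admissible_node G u"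
      using u none by (auto simp: F_def)
    obtain S where S: "\<And>x. x \<in> neighbours G u \<Longrightarrow> tight (S x) \<and> u \<notin> S x \<and> S x \<inter> neighbours G u = {x}"
        "\<And>x y. x \<in> neighbours G u \<Longrightarrow> y \<in> neighbours G u \<Longrightarrow> x \<noteq> y \<Longrightarrow> S x \<inter> S y = {}"
      using inadmissible_free_node[OF fu nu] by blast
    \<comment> \<open>A tight subset that misses \<open>u\<close> but contains a neighbour of
      \<open>u\<close> lies in no \<open>K\<^sub>4\<close>, so it suffices that this neighbour is
      not free.\<close>
    have attached: False
      if R: "tight R" "R \<subseteq> A" "u \<notin> R" "c \<in> R" "c \<in> neighbours G u" "\<not> free_node c" for R c
    proof -
      have "card (V - A) \<le> card (V - R)" using R(2) by (intro card_mono) auto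
      then have "card (V - R) \<ge> 2" using less.prems(2) by linarith
      moreover have "{c, u} \<in> E" using R(5) by (simp add: neighbours_def)
      ultimately have "\<not> R \<subseteq> K" if "K4_set K" for K
        using attached_not_in_K4[OF R(1) _ fu R(3,4)] that by blast
      then have "\<exists>v\<in>A. admissible_node G v" using smaller[of R c] R uA by blast
      then show False using none by blast
    qed
    show False
    proof (cases "\<exists>a\<in>neighbours G u \<inter> A. \<not> free_node a")
      case True
      then obtain a where a: "a \<in> neighbours G u" "a \<in> A" "\<not> free_node a" by blast
      have Sa: "tight (S a)" "u \<notin> S a" "a \<in> S a" using S(1)[OF a(1)] by blast+
      show False
      proof (cases "A \<union> S a = V")
        case False
        then have "tight (A \<inter> S a)" using less.prems(1) Sa a(2) by (intro tight_uncross) blast+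
        then show False using attached[of "A \<inter> S a" a] Sa a by blast
      next
        case True
        \<comment> \<open>The sets around the other two neighbours are disjoint from
          \<open>S a\<close>, hence inside \<open>A\<close>. Descent forces both neighbours to be
          free, but a leaf has at most one free neighbour in \<open>A\<close>.\<close>
        have SA: "S c \<subseteq> A" if "c \<in> neighbours G u - {a}" for c
        proof -
          have "S c \<inter> S a = {}" "S c \<subseteq> V" using S that a(1) unfolding tight_def by blast+
          then show ?thesis using True by blast
        qed
        have "free_node c" if c: "c \<in> neighbours G u - {a}" for c
        proof -
          have "tight (S c)" "u \<notin> S c" "c \<in> S c" using S(1)[of c] c by blast+
          then show ?thesis using attached[of "S c" c] SA[OF c] c by blast
        qed
        moreover have "c \<in> A" if c: "c \<in> neighbours G u - {a}" for c
          using S(1)[of c] SA[OF c] c by blast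
        ultimately have "neighbours G u - {a} \<subseteq> neighbours G u \<inter> F" unfolding F_def by blast
        then have "card (neighbours G u - {a}) \<le> card (neighbours G u \<inter> F)"
          by (intro card_mono) auto
        moreover have "card (neighbours G u - {a}) = 2"
          using a(1) free_nodeD(2)[OF fu] card_neighbours[of u] by simp
        ultimately show False using u(2) by linarith
      qed
    next
      case False
      \<comment> \<open>Here \<open>u\<close> has at most one neighbour in \<open>A\<close>, so
        deleting it leaves a tight set. The free neighbour \<open>w\<close> keeps that set out of
        every \<open>K\<^sub>4\<close>, and \<open>b\<close> is still in it.\<close>
      then have "neighbours G u \<inter> A \<subseteq> neighbours G u \<inter> F" unfolding F_def by blast
      then have le: "card (neighbours G u \<inter> A) \<le> 1"
        using u(2) card_mono[of "neighbours G u \<inter> F" "neighbours G u \<inter> A"] by simp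
      have split: "card (neighbours G u - A) + card (neighbours G u \<inter> A) = 3"
        using card_Diff_subset_Int[of "neighbours G u" A] card_mono[of "neighbours G u" "neighbours G u \<inter> A"]
          card_neighbours[of u] free_nodeD(2)[OF fu] by simp
      have bu: "b \<in> A - {u}" using less.prems(4,5) fu by blast
      have "touch (A - {u}) \<ge> 2 * card (A - {u}) + 1" using bu AV by (intro touch_ge) blast+
      then have "card (neighbours G u - A) = 2" and tu: "touch (A - {u}) = 2 * card (A - {u}) + 1"
        using touch_remove[OF uA] card.remove[OF fA uA] tA le split by linarith+
      then have "card (neighbours G u \<inter> A) = 1" using split by linarith
      then obtain w where "neighbours G u \<inter> A = {w}" using card_1_singletonE by blast
      then have w: "w \<in> neighbours G u" "w \<in> A" by blast+
      have "free_node w" "w \<noteq> u" using False w neighbours_sub by blast+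
      then have "\<not> A - {u} \<subseteq> K" if "K4_set K" for K using free_nodeD(4)[OF _ that] w(2) by blast
      moreover have "tight (A - {u})" using tu bu AV unfolding tight_def by blast
      ultimately show False using smaller[of "A - {u}" b] bu less.prems(5) uA none by blast
    qed
  qed
qed

section \<open>Two free nodes and two admissible nodes in the whole graph\<close>

text \<open>If some \<open>K\<close> is a \<open>K\<^sub>4\<close>, its complement is a tight set.
  Were that inside another \<open>K'\<close>, the two would cover \<open>V\<close>: one common
  vertex gives \<open>H2\<close>, none contradicts \<open>critical_disjoint\<close>. Without any
  \<open>K\<^sub>4\<close>, all nodes are free and the degree sum \<open>4 * card V - 2\<close>
  yields two of them.\<close>

lemma two_free_nodes_in_V: "card {v \<in> V. free_node v} \<ge> 2"
proof (cases "\<exists>K. K4_set K")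
  case True
  then obtain K where K: "K4_set K" by blast
  note KD = K4_setD[OF K]
  let ?A = "V - K"
  have "tight ?A" using KD(1,4) critical_iff_tight by blast
  moreover have VA: "V - ?A = K" using KD(1) by blast
  moreover have cA: "card ?A \<ge> 2" using card_V_ge_6 card_compl[OF KD(1)] KD(2) by linarith
  moreover have "\<not> ?A \<subseteq> K'" if K': "K4_set K'" for K'
  proof
    assume sub: "?A \<subseteq> K'"
    note KD' = K4_setD[OF K']
    have un: "K \<union> K' = V" using sub KD(1) KD'(1) by blast
    have "K \<noteq> K'"
    proof
      assume "K = K'"
      then have "card V = 4" using un KD(2) by simp
      then show False using card_V_ge_6 by simp
    qed
    then have "card (K \<inter> K') \<le> 1" using K4_sets_cap[OF K K'] by blast
    moreover have "card (K \<inter> K') \<noteq> 1" using H2_if_K4s[OF K K' _ un] not_H2 by blast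
    ultimately have "card (K \<inter> K') = 0" by linarith
    then have "K \<inter> K' = {}" using KD(3) by simp
    then show False using critical_disjoint[OF KD(4) KD'(4) _ un] KD(2) KD'(2) by simp
  qed
  ultimately have "card {v \<in> ?A. free_node v} \<ge> 2" using KD(2) by (intro two_free_nodes) simp_all
  also have "card {v \<in> ?A. free_node v} \<le> card {v \<in> V. free_node v}" by (intro card_mono) auto
  finally show ?thesis .
next
  case False
  let ?N = "{v \<in> V. touch {v} = 3}"
  have N: "{v \<in> V. free_node v} = ?N" using False by (auto simp: free_node_def)
  have "4 \<le> touch {v} + (if touch {v} = 3 then 1 else 0)" if "v \<in> V" for v
    using touch_ge[of "{v}"] critical_singleton[OF that] by (auto simp: critical_def)
  then have "(\<Sum>v\<in>V. 4) \<le> (\<Sum>v\<in>V. touch {v} + (if touch {v} = 3 then 1 else 0))" by (rule sum_mono)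
  also have "\<dots> = (\<Sum>v\<in>V. touch {v}) + card ?N" by (simp add: sum.distrib sum.If_cases Int_def)
  also have "(\<Sum>v\<in>V. touch {v}) = 2 * card E"
    using handshake[of V] ind_V touch_V by simp
  finally show ?thesis using card_E unfolding N by simp
qed

lemma two_admissible_nodes: "card {v \<in> V. admissible_node G v} \<ge> 2"
proof -
  let ?N = "{v \<in> V. free_node v}"
  have two: ?thesis if "v \<noteq> w" "v \<in> V" "w \<in> V" "admissible_node G v" "admissible_node G w" for v w
    using card_mono[of "{v \<in> V. admissible_node G v}" "{v, w}"] that by simp
  have leaf: ?thesis
    if u: "u \<in> ?N" "card (neighbours G u \<inter> ?N) \<le> 1" and nu: "\<not> admissible_node G u" for u
  proof -
    have fu: "free_node u" and uV: "u \<in> V" using u by blast+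
    obtain S where S: "\<And>x. x \<in> neighbours G u \<Longrightarrow> tight (S x) \<and> u \<notin> S x \<and> S x \<inter> neighbours G u = {x}"
        "\<And>x y. x \<in> neighbours G u \<Longrightarrow> y \<in> neighbours G u \<Longrightarrow> x \<noteq> y \<Longrightarrow> S x \<inter> S y = {}"
      using inadmissible_free_node[OF fu nu] by blast
    \<comment> \<open>A leaf has three neighbours and at most one of them is free; the sets around
      two others are disjoint, so they supply different admissible nodes.\<close>
    have "card (neighbours G u - ?N) = card (neighbours G u) - card (neighbours G u \<inter> ?N)"
      by (simp add: card_Diff_subset_Int)
    then have "\<not> card (neighbours G u - ?N) \<le> Suc 0"
      using u(2) card_neighbours[of u] free_nodeD(2)[OF fu] by linarith
    moreover have fin: "finite (neighbours G u - ?N)" by simp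
    ultimately obtain c d where cd: "c \<in> neighbours G u - ?N" "d \<in> neighbours G u - ?N" "c \<noteq> d"
      unfolding card_le_Suc0_iff_eq[OF fin] by blast
    have ex: "\<exists>v\<in>S x. admissible_node G v"
      if x: "x \<in> neighbours G u - ?N" and y: "y \<in> neighbours G u" "x \<noteq> y" for x y
    proof (rule admissible_in_tight)
      have "x \<in> neighbours G u" using x by (rule DiffD1)
      then have Sx: "tight (S x)" "u \<notin> S x" "x \<in> S x" and Sx_cap: "S x \<inter> neighbours G u = {x}"
        using S(1)[of x] by blast+
      have "y \<notin> S x" using y Sx_cap by (metis IntI singletonD)
      show "tight (S x)" by fact
      \<comment> \<open>The second neighbour \<open>y\<close>, together with \<open>u\<close>, gives
        the complement of \<open>S x\<close> its required two vertices.\<close>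
      have "{u, y} \<subseteq> V - S x" "u \<noteq> y" using uV y neighbours_sub Sx(2) \<open>y \<notin> S x\<close> by blast+
      then show c2: "card (V - S x) \<ge> 2" using card_mono[of "V - S x" "{u, y}"] by simp
      have "{x, u} \<in> E" using x by (simp add: neighbours_def)
      then show "\<not> S x \<subseteq> K" if "K4_set K" for K
        using attached_not_in_K4[OF Sx(1) c2 fu Sx(2,3)] that by blast
      show "x \<in> S x" by fact
      show "\<not> free_node x" using x neighbours_sub by blast
    qed
    obtain v where v: "v \<in> S c" "admissible_node G v" using ex[of c d] cd by blast
    obtain w where w: "w \<in> S d" "admissible_node G w" using ex[of d c] cd by blast
    have "v \<noteq> w" using S(2)[of c d] cd v(1) w(1) by blast
    moreover have "v \<in> V" "w \<in> V" using v w by (auto simp: admissible_node_def node_def)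
    ultimately show ?thesis using two v(2) w(2) by blast
  qed
  obtain u w where "u \<in> ?N" "w \<in> ?N" "u \<noteq> w" "card (neighbours G u \<inter> ?N) \<le> 1"
      "card (neighbours G w \<inter> ?N) \<le> 1"
    using two_node_leaves[OF two_free_nodes_in_V] free_nodeD(2) by blast
  then show ?thesis using leaf two by blast
qed

end

theorem theorem2p2:
  fixes G :: "'a ugraph"
  assumes "M22_circuit G"
    and "\<not> graph_iso G K5_minus_edge"
    and "\<not> graph_iso G H1"
    and "\<not> graph_iso G H2"
    and "\<not> (\<exists>F1 F2. nontrivial_two_vertex_separation G F1 F2)"
    and "\<not> (\<exists>F1 F2 S. nontrivial_three_edge_separation G F1 F2 S)"
  shows "card {v \<in> verts G. admissible_node G v} \<ge> 2"
proof -
  interpret reduced_circuit G using assms by unfold_locales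
  show ?thesis by (rule two_admissible_nodes)
qed

end
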